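(* Let $r,s\ge 0$ be integers and $P=[0,r]\times[0,s]$. For every file $F$ of $P$, $$\prod_{k=0}^{r+s+1}\ \prod_{(i,j)\in F}\rho_B^{k}(i,j)=1,$$ i.e., the statistic $f\mapsto\prod_{(i,j)\in F}f(i,j)$ on labelings $f$ is birationally homomesic under the action of birational rowmotion $\rho_B$. More specifically, a file $F$ is determined by its element on the upper boundary, of the form $(r,d)$ with $0\le d\le s$ or $(d,s)$ with $0\le d\le r$; and, assuming without loss of generality $s\le r$, the identity above becomes one of the following: $$\text{(a)}\quad \prod_{k=0}^{r+s+1}\prod_{c=0}^{d}\rho_B^{k+1}(r-c,d-c)=1\quad\text{if } d<s\le r;$$ $$\text{(b)}\quad \prod_{k=0}^{r+s+1}\prod_{c=0}^{d}\rho_B^{k+1}(d-c,s-c)=1\quad\text{if } d<s\le r;$$ $$\text{(c)}\quad \prod_{k=0}^{r+s+1}\prod_{c=0}^{s}\rho_B^{k+1}(d-c,s-c)=1\quad\text{if } s\le d\le r.$$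
   Context: For an integer $n\ge 0$, $[0,n]=\{0,1,\dots,n\}$. $P=[0,r]\times[0,s]$ is ordered componentwise (product of two chains); $\widehat P$ is $P$ with a new global minimum $\hat 0$ and a new global maximum $\hat 1$ adjoined. Write $w\lessdot v$ when $v$ covers $w$ in $\widehat P$. For fixed $q$, the $q$-th file of $P$ is $F=\{(i,j)\in P: j-i=q\}$. The upper boundary of $P$ is $\{(i,j)\in P: i=r\text{ or }j=s\}$. Birational rowmotion. Let $\mathbb K$ be a field. For $v\in P$ the birational toggle $T_v:\mathbb K^{\widehat P}\dashrightarrow\mathbb K^{\widehat P}$ is the rational map with $(T_vf)(y)=f(y)$ for $y\ne v$ and $$(T_vf)(v)=\frac{1}{f(v)}\cdot\frac{\sum_{w\in\widehat P,\,w\lessdot v}f(w)}{\sum_{z\in\widehat P,\,z\gtrdot v}1/f(z)}.$$ Birational rowmotion is $\rho_B=T_{v_1}T_{v_2}\cdots T_{v_n}$ where $v_1,\dots,v_n$ is any linear extension of $P$ (so toggling is performed from top to bottom); the result does not depend on the linear extension. The generic initial labeling assigns an indeterminate $x_{ij}$ to each $(i,j)\in P$ and the label $1$ to $\hat 0$ and $\hat 1$; all labelings considered have label $1$ at $\hat 0$ and $\hat 1$. $\rho_B^{k}(i,j)$ denotes the label of $(i,j)$ after $k$ applications of $\rho_B$ to the generic initial labeling, a rational function in the $x_{u,v}$; in particular $\rho_B^0(i,j)=x_{ij}$. It is known that $\rho_B$ on $P$ is periodic with period $r+s+2$ (as a rational map). Given an action $\tau$ of period $n$ on a set $S$ of objects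 and a statistic $\xi:S\to\mathbb K$, $\xi$ is called birationally homomesic if $\prod_{k=0}^{n-1}\xi(\tau^k(f))$ is a constant in $\mathbb K$ independent of $f\in S$ (here: $f$ a generic labeling). *)

theory Defs
  imports
    "HOL-Library.Poly_Mapping"
    "HOL-Library.Product_Order"
    "HOL-Library.Nat_Bijection"
    "HOL-Computational_Algebra.Fraction_Field"
begin

section \<open>Posets with adjoined bounds\<close>

datatype 'a hat = Bot | Elt 'a | Top

definition hat_carrier :: "'a set \<Rightarrow> 'a hat set" where
  "hat_carrier P = insert Bot (insert Top (Elt ` P))"

fun hat_less :: "'a::order hat \<Rightarrow> 'a hat \<Rightarrow> bool" where
  "hat_less Bot y \<longleftrightarrow> y \<noteq> Bot"
| "hat_less (Elt a) Bot \<longleftrightarrow> False"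
| "hat_less (Elt a) (Elt b) \<longleftrightarrow> a < b"
| "hat_less (Elt a) Top \<longleftrightarrow> True"
| "hat_less Top y \<longleftrightarrow> False"

text \<open>In \<open>covered_by P w v\<close> it is \<open>v\<close> that covers \<open>w\<close>.\<close>

definition covered_by :: "'a::order set \<Rightarrow> 'a hat \<Rightarrow> 'a hat \<Rightarrow> bool" where
  "covered_by P w v \<longleftrightarrow> w \<in> hat_carrier P \<and> v \<in> hat_carrier P \<and> hat_less w v \<and>
     \<not> (\<exists>u\<in>hat_carrier P. hat_less w u \<and> hat_less u v)"

definition linear_extension :: "'a::order set \<Rightarrow> 'a list \<Rightarrow> bool" where
  "linear_extension P vs \<longleftrightarrow> distinct vs \<and> set vs = P \<and>
     (\<forall>i<length vs. \<forall>j<length vs. vs ! i < vs ! j \<longrightarrow> i < j)"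

section \<open>Birational rowmotion\<close>

text \<open>
  A labeling is a total function on the type \<open>'a hat\<close>; its values outside \<open>hat_carrier P\<close> are
  never read or changed by the toggles.
\<close>

definition toggle :: "'a::order set \<Rightarrow> 'a \<Rightarrow> ('a hat \<Rightarrow> 'k::field) \<Rightarrow> 'a hat \<Rightarrow> 'k" where
  "toggle P v f = f(Elt v :=
     1 / f (Elt v) *
     ((\<Sum>w | covered_by P w (Elt v). f w) / (\<Sum>z | covered_by P (Elt v) z. 1 / f z)))"

text \<open>
  The composite \<open>T\<^bsub>v\<^sub>1\<^esub> \<circ> \<dots> \<circ> T\<^bsub>v\<^sub>n\<^esub>\<close> for \<open>vs = [v\<^sub>1, \<dots>, v\<^sub>n]\<close>: the last element is toggled first.
\<close>

definition birational_rowmotion ::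
    "'a::order set \<Rightarrow> 'a list \<Rightarrow> ('a hat \<Rightarrow> 'k::field) \<Rightarrow> 'a hat \<Rightarrow> 'k" where
  "birational_rowmotion P vs = foldr (toggle P) vs"

text \<open>
  Toggles are only partially defined, whereas division is total in HOL. The following predicates
  single out the labelings at which no division by zero occurs.
\<close>

definition toggle_defined :: "'a::order set \<Rightarrow> 'a \<Rightarrow> ('a hat \<Rightarrow> 'k::field) \<Rightarrow> bool" where
  "toggle_defined P v f \<longleftrightarrow> f (Elt v) \<noteq> 0 \<and> (\<forall>z. covered_by P (Elt v) z \<longrightarrow> f z \<noteq> 0) \<and>
     (\<Sum>z | covered_by P (Elt v) z. 1 / f z) \<noteq> 0"

fun rowmotion_defined :: "'a::order set \<Rightarrow> 'a list \<Rightarrow> ('a hat \<Rightarrow> 'k::field) \<Rightarrow> bool" where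
  "rowmotion_defined P [] f \<longleftrightarrow> True"
| "rowmotion_defined P (v # vs) f \<longleftrightarrow>
     rowmotion_defined P vs f \<and> toggle_defined P v (birational_rowmotion P vs f)"

definition rowmotion_labelings :: "'a::order set \<Rightarrow> 'a list \<Rightarrow> ('a hat \<Rightarrow> 'k::field) set" where
  "rowmotion_labelings P vs = {f. f Bot = 1 \<and> f Top = 1 \<and>
     (\<forall>k. rowmotion_defined P vs ((birational_rowmotion P vs ^^ k) f))}"

text \<open>Here \<open>\<tau>\<close> is meant to be an action of period \<open>n\<close> on \<open>S\<close>.\<close>

definition birationally_homomesic ::
    "('s \<Rightarrow> 's) \<Rightarrow> nat \<Rightarrow> 's set \<Rightarrow> ('s \<Rightarrow> 'k::field) \<Rightarrow> bool" where
  "birationally_homomesic \<tau> n S \<xi> \<longleftrightarrow> (\<exists>c. \<forall>f\<in>S. (\<Prod>k<n. \<xi> ((\<tau> ^^ k) f)) = c)"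

section \<open>Generic labelings of a rectangle\<close>

text \<open>
  The field of rational functions over \<open>'k\<close> in indeterminates \<open>x\<^sub>i\<^sub>j\<close>, one for each pair
  of natural numbers. The pairs are coded as natural numbers because the library proves that
  polynomials form an integral domain only for linearly ordered index types.
\<close>

type_synonym 'k ratfun = "((nat, nat) poly_mapping, 'k) poly_mapping fract"

definition indet :: "nat \<times> nat \<Rightarrow> 'k::field ratfun" where
  "indet v = Fract (Poly_Mapping.single (Poly_Mapping.single (prod_encode v) 1) 1) 1"

fun generic_labeling :: "(nat \<times> nat) hat \<Rightarrow> 'k::field ratfun" where
  "generic_labeling Bot = 1"
| "generic_labeling (Elt v) = indet v"
| "generic_labeling Top = 1"

text \<open>The order on \<open>nat \<times> nat\<close> is the componentwise one of \<open>HOL-Library.Product_Order\<close>.\<close>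

definition rect :: "nat \<Rightarrow> nat \<Rightarrow> (nat \<times> nat) set" where
  "rect r s = {0..r} \<times> {0..s}"

definition file_of :: "nat \<Rightarrow> nat \<Rightarrow> int \<Rightarrow> (nat \<times> nat) set" where
  "file_of r s q = {(i, j) \<in> rect r s. int j - int i = q}"

definition upper_boundary :: "nat \<Rightarrow> nat \<Rightarrow> (nat \<times> nat) set" where
  "upper_boundary r s = {(i, j) \<in> rect r s. i = r \<or> j = s}"

text \<open>The label \<open>\<rho>\<^sub>B\<^sup>k(i, j)\<close>, where \<open>vs\<close> is the linear extension used to compute \<open>\<rho>\<^sub>B\<close>.\<close>

definition rho ::
    "nat \<Rightarrow> nat \<Rightarrow> (nat \<times> nat) list \<Rightarrow> nat \<Rightarrow> nat \<times> nat \<Rightarrow> 'k::field ratfun" where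
  "rho r s vs k v = (birational_rowmotion (rect r s) vs ^^ k) generic_labeling (Elt v)"

end

theory Submission
  imports Defs
begin

text \<open>
  Write \<open>x\<^sub>k(v)\<close> for the labels along an orbit. Weight each vertex \<open>v\<close> by \<open>A\<^sub>k(v)\<close>, the label divided by the
  sum of the labels below it, or by \<open>V\<^sub>k(v)\<close>, the inverse of the label times the sum of the inverse
  labels above it; the toggle relation says \<open>V\<^sub>k\<^sub>+\<^sub>1 = A\<^sub>k\<close>. Planar duality identifies the sum over lattice
  paths from \<open>(i + 1, s)\<close> to \<open>(a + 1, 0)\<close> weighted by \<open>A\<^sub>k\<close> with the sum over paths from \<open>(i, s)\<close> to
  \<open>(a, 0)\<close> weighted by \<open>V\<^sub>k\<close>. Alternating the two identities moves \<open>1 / x(a, 0)\<close> to the antipodal vertex,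
  which gives the reciprocity \<open>x\<^bsub>k+i+j+1\<^esub>(i, j) x\<^sub>k(r - i, s - j) = 1\<close> and hence the period \<open>r + s + 2\<close>.

  Put \<open>B\<^sub>t(q) = \<Prod> x\<^bsub>t+j\<^esub>(i, j)\<close> over the \<open>q\<close>-th file. Multiplying the toggle relations along a file, with
  the time advancing by one at each step, makes the sums telescope, so that
  \<open>B\<^sub>t\<^sub>+\<^sub>1(q) B\<^sub>t(q) = B\<^sub>t\<^sub>+\<^sub>1(q - 1) B\<^sub>t(q + 1)\<close> with \<open>B = 1\<close> just outside the rectangle. Therefore \<open>B\<^sub>t(q)\<close> is a
  product of consecutive terms of the sequence \<open>B\<^sub>m(-r)\<close>, and \<open>B\<^sub>t(s + 1) = 1\<close> says that any \<open>r + s + 2\<close>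
  consecutive terms have product \<open>1\<close>.

  All iterates of the generic labeling are defined because toggling it is an involution and so
  induces an endomorphism of the field of rational functions.
\<close>

section \<open>Path sums on a rectangle\<close>

text \<open>The value \<open>1\<close> at \<open>(0, 0)\<close> is the label of the adjoined
  minimum; the one at \<open>(r, s)\<close> in \<open>upper_sum\<close> is the inverse label of the
  adjoined maximum.\<close>

definition lower_sum :: "(nat \<Rightarrow> nat \<Rightarrow> 'a::field) \<Rightarrow> nat \<Rightarrow> nat \<Rightarrow> 'a" where
  "lower_sum f i j = (if i = 0 \<and> j = 0 then 1
     else (if i = 0 then 0 else f (i - 1) j) + (if j = 0 then 0 else f i (j - 1)))"

definition upper_sum :: "nat \<Rightarrow> nat \<Rightarrow> (nat \<Rightarrow> nat \<Rightarrow> 'a::field) \<Rightarrow> nat \<Rightarrow> nat \<Rightarrow> 'a" where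
  "upper_sum r s f i j = (if i = r \<and> j = s then 1
     else (if i = r then 0 else 1 / f (Suc i) j) + (if j = s then 0 else 1 / f i (Suc j)))"

text \<open>
  The sum, over all lattice paths that descend from \<open>(i, j)\<close> to \<open>(a, 0)\<close>, of the product of the
  weights of the vertices visited.
\<close>

fun path_sum :: "(nat \<Rightarrow> nat \<Rightarrow> 'a::field) \<Rightarrow> nat \<Rightarrow> nat \<Rightarrow> nat \<Rightarrow> 'a" where
  "path_sum w a 0 0 = w 0 0 * of_bool (a = 0)"
| "path_sum w a (Suc i) 0 = w (Suc i) 0 * (of_bool (a = Suc i) + path_sum w a i 0)"
| "path_sum w a 0 (Suc j) = w 0 (Suc j) * path_sum w a 0 j"
| "path_sum w a (Suc i) (Suc j) =
     w (Suc i) (Suc j) * (path_sum w a i (Suc j) + path_sum w a (Suc i) j)"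

lemma path_sum_cong:
  assumes "\<And>i' j'. i' \<le> i \<Longrightarrow> j' \<le> j \<Longrightarrow> w i' j' = w' i' j'"
  shows "path_sum w a i j = path_sum w' a i j"
  using assms by (induction w a i j rule: path_sum.induct) auto

lemma path_sum_eq_0: "i < a \<Longrightarrow> path_sum w a i j = 0"
  by (induction w a i j rule: path_sum.induct) auto

locale rectangle_labeling =
  fixes r s :: nat and y :: "nat \<Rightarrow> nat \<Rightarrow> 'a::field"
  assumes nonzero: "i \<le> r \<Longrightarrow> j \<le> s \<Longrightarrow> y i j \<noteq> 0"
    and lower_sum_nonzero: "i \<le> r \<Longrightarrow> j \<le> s \<Longrightarrow> lower_sum y i j \<noteq> 0"
begin

text \<open>With two covers present, clearing denominators turns the inverse labels into the sum of
  the two labels, a lower sum one diagonal step up. Otherwise the sum is a single inverse label or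
  \<open>1\<close>.\<close>

lemma upper_sum_nonzero:
  assumes "i \<le> r" "j \<le> s"
  shows "upper_sum r s y i j \<noteq> 0"
proof (cases "i < r \<and> j < s")
  case True
  then have "upper_sum r s y i j * (y (Suc i) j * y i (Suc j)) = lower_sum y (Suc i) (Suc j)"
    using nonzero[of "Suc i" j] nonzero[of i "Suc j"]
    by (simp add: upper_sum_def lower_sum_def field_simps)
  then show ?thesis using lower_sum_nonzero[of "Suc i" "Suc j"] True by auto
next
  case False
  then show ?thesis
    using assms nonzero[of "Suc i" j] nonzero[of i "Suc j"] by (auto simp: upper_sum_def)
qed

definition lower_weight :: "nat \<Rightarrow> nat \<Rightarrow> 'a" where
  "lower_weight i j = y i j / lower_sum y i j"

definition upper_weight :: "nat \<Rightarrow> nat \<Rightarrow> 'a" where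
  "upper_weight i j = 1 / (y i j * upper_sum r s y i j)"

text \<open>A label is its lower weight times the sum of the labels below it, which is exactly the
  recursion of path sums; at \<open>(0, 0)\<close> both sides are \<open>y 0 0\<close>.\<close>

lemma path_sum_lower_weight:
  assumes "i \<le> r" "j \<le> s"
  shows "path_sum lower_weight 0 i j = y i j"
  using assms
proof (induction lower_weight "0::nat" i j rule: path_sum.induct)
  case 1
  then show ?case by (simp add: lower_weight_def lower_sum_def)
next
  case (2 i)
  then show ?case using lower_sum_nonzero[of "Suc i" 0] nonzero[of i 0]
    by (simp add: lower_weight_def lower_sum_def)
next
  case (3 j)
  then show ?case using lower_sum_nonzero[of 0 "Suc j"]
    by (simp add: lower_weight_def lower_sum_def)
next
  case (4 i j)
  then show ?case using lower_sum_nonzero[of "Suc i" "Suc j"]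
    by (simp add: lower_weight_def lower_sum_def)
qed

context
  fixes a :: nat
begin

text \<open>
  Here \<open>stream_fun\<close> is harmonic for the edge weights given by the labels, and \<open>flux\<close> describes a flow with
  a source at \<open>(a, 0)\<close>; the equations \<open>stream_equations\<close> say that they are dual to each other, like a
  stream function and its flow in the plane.
\<close>

definition stream_fun :: "nat \<Rightarrow> nat \<Rightarrow> 'a" where
  "stream_fun i j = (if j \<le> s then path_sum lower_weight (Suc a) i j / y i j else 0)"

definition flux :: "nat \<Rightarrow> nat \<Rightarrow> 'a" where
  "flux i j = path_sum upper_weight a i j"

definition inflow1 :: "nat \<Rightarrow> nat \<Rightarrow> 'a" where
  "inflow1 i j = (if i = 0 then 0 else flux (i - 1) j) / y i j"

definition inflow2 :: "nat \<Rightarrow> nat \<Rightarrow> 'a" where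
  "inflow2 i j = (if j = 0 then of_bool (i = a) else flux i (j - 1)) / y i j"

text \<open>Conservation of flow, if the edge from \<open>(i, j)\<close> up to a cover
  \<open>v\<close> carries \<open>flux i j\<close> divided by the label of \<open>v\<close>: the
  left side is the total outflow. The \<open>of_bool\<close> term in \<open>inflow2\<close> is the
  source.\<close>

lemma flow_balance:
  assumes "i \<le> r" "j \<le> s"
  shows "flux i j * upper_sum r s y i j = inflow1 i j + inflow2 i j"
proof -
  define p where "p = (if i = 0 then 0 else flux (i - 1) j)"
  define q where "q = (if j = 0 then of_bool (i = a) else flux i (j - 1))"
  have "flux i j = upper_weight i j * (p + q)"
    unfolding flux_def p_def q_def by (cases i; cases j) auto
  then show ?thesis
    using nonzero[OF assms] upper_sum_nonzero[OF assms]
    unfolding upper_weight_def inflow1_def inflow2_def p_def[symmetric] q_def[symmetric]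
    by (simp add: field_simps)
qed

text \<open>Dividing the path sum by the label cancels the numerator of \<open>lower_weight\<close>,
  so only a weighted mean of the two values below remains.\<close>

lemma stream_fun_average:
  assumes "i < r" "j < s"
  shows "(y i (Suc j) + y (Suc i) j) * stream_fun (Suc i) (Suc j) =
    y i (Suc j) * stream_fun i (Suc j) + y (Suc i) j * stream_fun (Suc i) j"
  using assms lower_sum_nonzero[of "Suc i" "Suc j"] nonzero[of "Suc i" "Suc j"]
    nonzero[of i "Suc j"] nonzero[of "Suc i" j]
  by (simp add: stream_fun_def lower_weight_def lower_sum_def)

text \<open>On the bottom row \<open>lower_weight\<close> is a quotient of consecutive labels, so
  \<open>stream_fun\<close> is constant there except for a jump by \<open>1 / y a 0\<close> between
  \<open>a\<close> and \<open>a + 1\<close>.\<close>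

lemma stream_fun_bottom_step:
  assumes "i < r"
  shows "stream_fun (Suc i) 0 - stream_fun i 0 = inflow2 i 0"
  using assms nonzero[of "Suc i" 0] nonzero[of i 0]
  by (auto simp: stream_fun_def lower_weight_def lower_sum_def inflow2_def field_simps)

lemma stream_fun_above [simp]: "stream_fun i (Suc s) = 0"
  by (simp add: stream_fun_def)

lemma stream_fun_eq_0: "i \<le> a \<Longrightarrow> stream_fun i j = 0"
  by (simp add: stream_fun_def path_sum_eq_0)

text \<open>The two equations at \<open>(i, j)\<close> and \<open>flow_balance\<close> give the
  difference of \<open>stream_fun\<close> between \<open>(i + 1, j)\<close> and
  \<open>(i, j + 1)\<close>. By \<open>stream_fun_average\<close> the value at
  \<open>(i + 1, j + 1)\<close> splits this difference in the ratio of the two outflows of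
  \<open>(i, j)\<close>.\<close>

lemma stream_equations_step:
  assumes "i < r" "j < s"
    and "stream_fun i j - stream_fun i (Suc j) = inflow1 i j" "stream_fun (Suc i) j - stream_fun i j = inflow2 i j"
  shows "stream_fun (Suc i) j - stream_fun (Suc i) (Suc j) = inflow1 (Suc i) j"
    and "stream_fun (Suc i) (Suc j) - stream_fun i (Suc j) = inflow2 i (Suc j)"
proof -
  define p q where "p = y (Suc i) j" and "q = y i (Suc j)"
  have pq: "p \<noteq> 0" "q \<noteq> 0" "p + q \<noteq> 0"
    using assms(1,2) nonzero lower_sum_nonzero[of "Suc i" "Suc j"]
    by (auto simp: p_def q_def lower_sum_def add.commute)
  have "flux i j * (1 / p + 1 / q) = stream_fun (Suc i) j - stream_fun i (Suc j)"
    using flow_balance[of i j] assms(1,2) unfolding assms(3,4)[symmetric]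
    by (simp add: upper_sum_def p_def q_def)
  then have G: "flux i j * (p + q) = p * q * (stream_fun (Suc i) j - stream_fun i (Suc j))"
    using pq by (simp add: field_simps)
  have H: "(q + p) * stream_fun (Suc i) (Suc j) = q * stream_fun i (Suc j) + p * stream_fun (Suc i) j"
    using stream_fun_average[OF assms(1,2)] by (simp add: p_def q_def)
  have "(p + q) * (p * (stream_fun (Suc i) j - stream_fun (Suc i) (Suc j))) = (p + q) * flux i j"
    using G H by algebra
  then have "p * (stream_fun (Suc i) j - stream_fun (Suc i) (Suc j)) = flux i j"
    using pq by simp
  then show "stream_fun (Suc i) j - stream_fun (Suc i) (Suc j) = inflow1 (Suc i) j"
    using pq by (auto simp: inflow1_def p_def field_simps)
  have "(p + q) * (q * (stream_fun (Suc i) (Suc j) - stream_fun i (Suc j))) = (p + q) * flux i j"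
    using G H by algebra
  then have "q * (stream_fun (Suc i) (Suc j) - stream_fun i (Suc j)) = flux i j"
    using pq by simp
  then show "stream_fun (Suc i) (Suc j) - stream_fun i (Suc j) = inflow2 i (Suc j)"
    using pq by (auto simp: inflow2_def q_def field_simps)
qed

text \<open>Induction over columns: the first equation in column \<open>i\<close> yields the second
  one there, row by row from the bottom, and both together yield the first one in column
  \<open>i + 1\<close>. In column \<open>0\<close> both sides of the first equation vanish.\<close>

lemma stream_equations:
  shows "i \<le> r \<Longrightarrow> j \<le> s \<Longrightarrow> stream_fun i j - stream_fun i (Suc j) = inflow1 i j"
    and "i < r \<Longrightarrow> j \<le> s \<Longrightarrow> stream_fun (Suc i) j - stream_fun i j = inflow2 i j"
proof -
  have second: "stream_fun (Suc i) j - stream_fun i j = inflow2 i j"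
    if "i < r" "j \<le> s" and first: "\<And>j. j \<le> s \<Longrightarrow> stream_fun i j - stream_fun i (Suc j) = inflow1 i j" for i j
    using that(2)
  proof (induction j)
    case 0
    then show ?case using that(1) by (rule_tac stream_fun_bottom_step)
  next
    case (Suc j)
    then show ?case using stream_equations_step(2)[of i j] first[of j] that(1) by simp
  qed
  have first: "stream_fun i j - stream_fun i (Suc j) = inflow1 i j" if "i \<le> r" "j \<le> s" for i j
    using that
  proof (induction i arbitrary: j)
    case 0
    then show ?case by (simp add: stream_fun_eq_0 inflow1_def)
  next
    case (Suc i)
    have IH: "stream_fun i j - stream_fun i (Suc j) = inflow1 i j" if "j \<le> s" for j
      using Suc.IH Suc.prems that by simp
    show ?case
    proof (cases "j = s")
      case True
      \<comment> \<open>On the top row the only cover lies to the right, and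
        \<open>stream_fun\<close> is \<open>0\<close> above the row, so the two inflows
        telescope.\<close>
      have "flux i s * (1 / y (Suc i) s) = stream_fun (Suc i) s"
        using flow_balance[of i s] Suc.prems
        unfolding IH[of s, OF order.refl, symmetric] second[OF _ order.refl IH, symmetric]
        by (simp add: upper_sum_def flip: IH second[OF _ order.refl IH])
      then show ?thesis using True by (simp add: inflow1_def)
    next
      case False
      then show ?thesis
        using stream_equations_step(1)[of i j] IH[of j] second[of i j] IH Suc.prems by simp
    qed
  qed
  show "i \<le> r \<Longrightarrow> j \<le> s \<Longrightarrow> stream_fun i j - stream_fun i (Suc j) = inflow1 i j" by (rule first)
  show "i < r \<Longrightarrow> j \<le> s \<Longrightarrow> stream_fun (Suc i) j - stream_fun i j = inflow2 i j"
    using second first by simp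
qed

text \<open>The first stream equation on the top row, multiplied by the label: the planar duality
  that exchanges the two kinds of weights.\<close>

lemma path_sum_conversion:
  assumes "Suc i \<le> r"
  shows "path_sum lower_weight (Suc a) (Suc i) s = path_sum upper_weight a i s"
  using stream_equations(1)[of "Suc i" s] assms nonzero[of "Suc i" s]
  by (simp add: stream_fun_def inflow1_def flux_def)

lemma stream_fun_bottom:
  assumes "i \<le> r" "a < i"
  shows "stream_fun i 0 = 1 / y a 0"
  using assms
proof (induction i)
  case (Suc i)
  then show ?case using stream_fun_bottom_step[of i] by (cases "i = a") (auto simp: inflow2_def stream_fun_eq_0)
qed simp

text \<open>By the first stream equation \<open>stream_fun r j\<close> is the flow entering the last
  column in rows \<open>j\<close> and above, while \<open>inflow2 r j\<close> arrives from below.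
  Together they make up the whole source, in every row.\<close>

lemma total_flow:
  assumes "a \<le> r" "j \<le> s"
  shows "stream_fun r j + inflow2 r j = 1 / y a 0"
  using assms(2)
proof (induction j)
  case 0
  show ?case
  proof (cases "a = r")
    case True
    then have "stream_fun r 0 = 0" by (intro stream_fun_eq_0) simp
    then show ?thesis unfolding inflow2_def using True by simp
  next
    case False
    then show ?thesis using stream_fun_bottom[of r] assms(1) by (simp add: inflow2_def)
  qed
next
  case (Suc j)
  have "flux r j / y r (Suc j) = stream_fun r j - stream_fun r (Suc j) + inflow2 r j"
    using flow_balance[of r j] stream_equations(1)[of r j] Suc.prems by (simp add: upper_sum_def)
  then show ?case using Suc by (simp add: inflow2_def)
qed

text \<open>All flow ends at \<open>(r, s)\<close>, where the upper sum is \<open>1\<close> and the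
  flux is therefore the total flow.\<close>

lemma path_sum_upper_weight:
  assumes "a \<le> r"
  shows "path_sum upper_weight a r s = 1 / y a 0"
  using flow_balance[of r s] stream_equations(1)[of r s] total_flow[of s] assms
  by (simp add: upper_sum_def flux_def stream_fun_def)

end

end

section \<open>Reciprocity and periodicity\<close>

text \<open>Toggling runs from top to bottom, so the labels above an element are already new and
  those below it still old; hence the two different times in \<open>toggle_relation\<close>.\<close>

locale rowmotion_orbit =
  fixes r s :: nat and x :: "nat \<Rightarrow> nat \<Rightarrow> nat \<Rightarrow> 'a::field"
  assumes labeling: "rectangle_labeling r s (x k)"
    and toggle_relation: "i \<le> r \<Longrightarrow> j \<le> s \<Longrightarrow>
      x (Suc k) i j * x k i j * upper_sum r s (x (Suc k)) i j = lower_sum (x k) i j"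
begin

sublocale rectangle_labeling r s "x k" for k
  by (rule labeling)

lemma upper_weight_Suc:
  assumes "i \<le> r" "j \<le> s"
  shows "upper_weight (Suc k) i j = lower_weight k i j"
  using toggle_relation[OF assms, of k] nonzero[OF assms] upper_sum_nonzero[OF assms]
    lower_sum_nonzero[OF assms]
  by (simp add: upper_weight_def lower_weight_def field_simps)

lemma path_sum_upper_weight_Suc:
  assumes "i \<le> r" "j \<le> s"
  shows "path_sum (upper_weight (Suc k)) a i j = path_sum (lower_weight k) a i j"
  using assms by (intro path_sum_cong upper_weight_Suc) auto

text \<open>Each round of \<open>path_sum_conversion\<close> and \<open>upper_weight_Suc\<close>
  lowers the end point, the column and the time by one; after \<open>a\<close> rounds the path sum
  ends at \<open>(0, 0)\<close> and is a label.\<close>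

lemma path_sum_shift:
  "i + a \<le> r \<Longrightarrow> path_sum (lower_weight (k + a)) a (i + a) s = x k i s"
proof (induction a)
  case 0
  then show ?case by (simp add: path_sum_lower_weight)
next
  case (Suc a)
  then have "path_sum (lower_weight (k + Suc a)) (Suc a) (i + Suc a) s =
      path_sum (upper_weight (Suc (k + a))) a (i + a) s"
    using path_sum_conversion[of "i + a" "k + Suc a" a] by simp
  then show ?case
    using Suc by (simp add: path_sum_upper_weight_Suc)
qed

lemma bottom_reciprocity:
  assumes "a \<le> r"
  shows "x (k + a + 1) a 0 * x k (r - a) s = 1"
proof -
  have "1 / x (k + a + 1) a 0 = path_sum (lower_weight (k + a)) a (r - a + a) s"
    using path_sum_upper_weight[OF assms, of "k + a + 1"] assms
    by (simp add: path_sum_upper_weight_Suc)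
  then have "1 / x (k + a + 1) a 0 = x k (r - a) s"
    using path_sum_shift[of "r - a" a k] assms by simp
  then show ?thesis
    using nonzero[of a 0 "k + a + 1"] assms by (simp add: field_simps)
qed

theorem reciprocity:
  assumes "i \<le> r" "j \<le> s"
  shows "x (k + i + j + 1) i j * x k (r - i) (s - j) = 1"
  using assms
proof (induction j arbitrary: i k rule: less_induct)
  case (less j')
  show ?case
  proof (cases j')
    case 0
    then show ?thesis using bottom_reciprocity[of i k] less.prems by simp
  next
    case (Suc j)
    have IH: "x (k + i + j + 1) i j = 1 / x k (r - i) (s - j)" if "i \<le> r" "j < j'" for k i j
      using less.IH[of j i k] less.prems that nonzero[of "r - i" "s - j" k]
      by (simp add: field_simps)
    define n where "n = k + i + j + 1"
    have ij: "i \<le> r" "j < s" using less.prems Suc by simp_all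
    \<comment> \<open>The toggle relation at \<open>(i, j)\<close> and time \<open>n\<close> is
      compared with the one at the antipode and time \<open>k\<close>. By \<open>IH\<close>,
      inversion turns the labels below \<open>(i, j)\<close> into the inverse labels above the
      antipode.\<close>
    have lower: "lower_sum (x n) i j = upper_sum r s (x (Suc k)) (r - i) (s - j)"
    proof -
      have "x n (i - 1) j = 1 / x (Suc k) (Suc (r - i)) (s - j)" if "0 < i"
        using IH[of "i - 1" j "Suc k"] that ij Suc by (simp add: n_def Suc_diff_le)
      moreover have "x n i (j - 1) = 1 / x (Suc k) (r - i) (Suc (s - j))" if "0 < j"
        using IH[of i "j - 1" "Suc k"] that ij Suc by (simp add: n_def Suc_diff_le)
      moreover have "i = 0 \<longleftrightarrow> r - i = r" "j = 0 \<longleftrightarrow> s - j = s" using ij by auto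
      ultimately show ?thesis by (simp add: lower_sum_def upper_sum_def)
    qed
    define b c where "b = x (Suc k) (r - i) (s - j)" and "c = x k (r - i) (s - j)"
    have bc: "b \<noteq> 0" "c \<noteq> 0" by (simp_all add: b_def c_def nonzero)
    have "x (Suc n) i j = 1 / b" "x n i j = 1 / c"
      using IH[of i j "Suc k"] IH[of i j k] ij Suc by (simp_all add: n_def b_def c_def)
    then have "1 / b * (1 / c) * upper_sum r s (x (Suc n)) i j = lower_sum (x n) i j"
      using toggle_relation[of i j n] ij by simp
    then have "upper_sum r s (x (Suc n)) i j = b * c * lower_sum (x n) i j"
      using bc by (simp add: field_simps)
    also have "\<dots> = lower_sum (x k) (r - i) (s - j)"
      unfolding lower b_def c_def by (rule toggle_relation) simp_all
    finally have upper: "upper_sum r s (x (Suc n)) i j = lower_sum (x k) (r - i) (s - j)" .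
    \<comment> \<open>The cover \<open>(i + 1, j)\<close> lies in row \<open>j\<close>, so
      \<open>IH\<close> matches its summand; what remains of \<open>upper\<close> is the claim for
      \<open>(i, j + 1)\<close>.\<close>
    have "1 / x (Suc n) (Suc i) j = x k (r - i - 1) (s - j)" if "i < r"
      using IH[of "Suc i" j k] that Suc by (simp add: n_def)
    then have "1 / x (Suc n) i (Suc j) = x k (r - i) (s - j')"
      using upper ij Suc by (auto simp: upper_sum_def lower_sum_def split: if_splits)
    then show ?thesis
      using nonzero[of i "Suc j" "Suc n"] ij Suc by (simp add: n_def field_simps)
  qed
qed

text \<open>Reciprocity is applied at the antipode and then at \<open>(i, j)\<close>; the two delays
  add up to \<open>r + s + 2\<close>.\<close>

theorem periodicity:
  assumes "i \<le> r" "j \<le> s"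
  shows "x (k + (r + s + 2)) i j = x k i j"
proof -
  define m where "m = k + (r - i) + (s - j) + 1"
  have "x (m + i + j + 1) i j * x m (r - i) (s - j) = 1"
    using reciprocity[OF assms] .
  moreover have "x m (r - i) (s - j) * x k i j = 1"
    using reciprocity[of "r - i" "s - j" k] assms by (simp add: m_def)
  moreover have "m + i + j + 1 = k + (r + s + 2)"
    using assms by (simp add: m_def)
  ultimately show ?thesis
    by (metis mult.commute mult.left_commute mult_1_right)
qed

end

section \<open>Products along files\<close>

lemma prod_lessThan_periodic_shift:
  fixes f :: "nat \<Rightarrow> 'a::field"
  assumes "\<And>k. f (k + n) = f k"
  shows "(\<Prod>k<n. f (k + c)) = (\<Prod>k<n. f k)"
proof (induction c)
  case (Suc c)
  show ?case
  proof (cases n)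
    case n: (Suc m)
    have "(\<Prod>k<n. f (k + Suc c)) = (\<Prod>k<m. f (Suc k + c)) * f (c + n)"
      by (simp add: n add.commute)
    also have "\<dots> = f (0 + c) * (\<Prod>k<m. f (Suc k + c))"
      by (simp add: assms)
    also have "\<dots> = (\<Prod>k<n. f (k + c))"
      unfolding n by (subst prod.lessThan_Suc_shift) simp
    finally show ?thesis using Suc by simp
  qed simp
qed simp

context rowmotion_orbit
begin

text \<open>
  Labels and lower sums are extended by \<open>1\<close> to the plane; with this convention the toggle
  relation holds at all vertices except the two corners \<open>(r, -1)\<close> and \<open>(-1, s)\<close>.
\<close>

definition padded :: "int \<Rightarrow> int \<Rightarrow> int \<Rightarrow> 'a" where
  "padded t i j = (if 0 \<le> i \<and> i \<le> int r \<and> 0 \<le> j \<and> j \<le> int s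
     then x (nat t) (nat i) (nat j) else 1)"

definition padded_lower :: "int \<Rightarrow> int \<Rightarrow> int \<Rightarrow> 'a" where
  "padded_lower t i j = (if 0 \<le> i \<and> i \<le> int r \<and> 0 \<le> j \<and> j \<le> int s
     then lower_sum (x (nat t)) (nat i) (nat j) else 1)"

lemma padded_nonzero: "padded t i j \<noteq> 0"
  by (auto simp: padded_def nonzero)

lemma padded_lower_nonzero: "padded_lower t i j \<noteq> 0"
  by (auto simp: padded_lower_def lower_sum_nonzero)

text \<open>Multiplying the toggle relation by the labels above \<open>(i, j)\<close> turns the
  upper sum into the lower sum at \<open>(i + 1, j + 1)\<close>. The hypothesis on \<open>t\<close>
  keeps \<open>nat\<close> from truncating a time at which a label is read.\<close>

lemma padded_relation:
  assumes "0 \<le> j \<Longrightarrow> 0 \<le> t" "(i, j) \<noteq> (int r, -1)" "(i, j) \<noteq> (-1, int s)"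
  shows "padded (t + 1) i j * padded t i j * padded_lower (t + 1) (i + 1) (j + 1) =
    padded_lower t i j * padded (t + 1) (i + 1) j * padded (t + 1) i (j + 1)"
proof (cases "0 \<le> i \<and> i \<le> int r \<and> 0 \<le> j \<and> j \<le> int s")
  case True
  define m n k where "m = nat i" and "n = nat j" and "k = nat t"
  have eqs: "i = int m" "j = int n" "t = int k" "m \<le> r" "n \<le> s"
    using True assms(1) by (auto simp: m_def n_def k_def)
  have nats: "nat (1 + int l) = Suc l" "nat (int l + 1) = Suc l" for l by simp_all
  have rel: "x (Suc k) m n * x k m n * upper_sum r s (x (Suc k)) m n = lower_sum (x k) m n"
    using toggle_relation eqs by simp
  show ?thesis
  proof (cases "m < r \<and> n < s")
    case True
    define p q where "p = x (Suc k) (Suc m) n" and "q = x (Suc k) m (Suc n)"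
    have "p \<noteq> 0" "q \<noteq> 0" using True by (simp_all add: p_def q_def nonzero)
    then have "upper_sum r s (x (Suc k)) m n * (p * q) = p + q"
      using True by (simp add: upper_sum_def field_simps flip: p_def q_def)
    then have "x (Suc k) m n * x k m n * (p + q) = lower_sum (x k) m n * (p * q)"
      using rel by algebra
    then show ?thesis
      using True by (simp add: eqs nats padded_def padded_lower_def lower_sum_def[of "x (Suc k)"]
          p_def q_def add.commute mult.assoc)
  next
    case False
    then show ?thesis
      using rel eqs(4,5) nonzero[of m "Suc n" "Suc k"] nonzero[of "Suc m" n "Suc k"]
      by (auto simp: eqs(1-3) nats padded_def padded_lower_def upper_sum_def field_simps split: if_splits)
  qed
next
  case False
  then have "padded (t + 1) i j = 1" "padded t i j = 1" "padded_lower t i j = 1"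
    unfolding padded_def padded_lower_def by meson+
  moreover have "padded_lower (t + 1) (i + 1) (j + 1) = padded (t + 1) (i + 1) j * padded (t + 1) i (j + 1)"
  proof -
    \<comment> \<open>Next to the left or bottom edge the lower sum on that edge has a single
      summand, or is \<open>1\<close> at \<open>(0, 0)\<close>. The last two cases are the excluded
      corners.\<close>
    consider "i = -1" "0 \<le> j" "j < int s" | "j = -1" "0 \<le> i" "i < int r" | "i = -1" "j = -1"
      | "i < -1 \<or> i > int r \<or> j < -1 \<or> j > int s"
      | "i = -1" "j = int s" | "i = int r" "j = -1"
      using False by linarith
    then show ?thesis
      using assms(2,3)
      by cases (auto simp: padded_def padded_lower_def lower_sum_def nat_add_distrib)
  qed
  ultimately show ?thesis by simp
qed

text \<open>This is \<open>B_t(q)\<close> of the overview. The extra rows \<open>-1\<close> and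
  \<open>s + 1\<close> contribute \<open>1\<close>; dropping one or the other accounts for an index
  shift.\<close>

definition skew_product :: "nat \<Rightarrow> int \<Rightarrow> 'a" where
  "skew_product t q = (\<Prod>j\<in>{-1..int s + 1}. padded (int t + j) (j - q) j)"

lemma prod_drop_last:
  fixes f :: "int \<Rightarrow> 'a"
  assumes "f (int s + 1) = 1"
  shows "(\<Prod>j\<in>{-1..int s + 1}. f j) = (\<Prod>j\<in>{-1..int s}. f j)"
proof (intro prod.mono_neutral_right ballI)
  fix j assume "j \<in> {-1..int s + 1} - {-1..int s}"
  then have "j = int s + 1" by auto
  then show "f j = 1" using assms by simp
qed auto

lemma prod_drop_first:
  fixes f :: "int \<Rightarrow> 'a"
  assumes "f (-1) = 1"
  shows "(\<Prod>j\<in>{-1..int s + 1}. f j) = (\<Prod>j\<in>{-1..int s}. f (j + 1))"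
proof -
  have "(\<Prod>j\<in>{-1..int s + 1}. f j) = (\<Prod>j\<in>{0..int s + 1}. f j)"
  proof (intro prod.mono_neutral_right ballI)
    fix j assume "j \<in> {-1..int s + 1} - {0..int s + 1}"
    then have "j = -1" by auto
    then show "f j = 1" using assms by simp
  qed auto
  also have "\<dots> = (\<Prod>j\<in>{-1..int s}. f (j + 1))"
    by (rule prod.reindex_bij_witness[where i = "\<lambda>j. j + 1" and j = "\<lambda>j. j - 1"]) auto
  finally show ?thesis .
qed

text \<open>In the product of \<open>padded_relation\<close> along the file, the lower sum on the
  left is the one on the right at the next vertex and time, so both sides contain the same nonzero
  factor \<open>P\<close>.\<close>

lemma skew_product_recurrence:
  assumes "- int r \<le> q" "q \<le> int s"
  shows "skew_product (Suc t) q * skew_product t q =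
    skew_product (Suc t) (q - 1) * skew_product t (q + 1)"
proof -
  let ?J = "{-1..int s}"
  have drop: "skew_product t q = (\<Prod>j\<in>?J. padded (int t + j) (j - q) j)" for t q
    unfolding skew_product_def by (rule prod_drop_last) (simp add: padded_def)
  have drop': "skew_product t q = (\<Prod>j\<in>?J. padded (int t + (j + 1)) (j + 1 - q) (j + 1))" for t q
    unfolding skew_product_def by (rule prod_drop_first) (simp add: padded_def)
  define P where "P = (\<Prod>j\<in>?J. padded_lower (int t + j) (j - q) j)"
  have P: "(\<Prod>j\<in>?J. padded_lower (int t + (j + 1)) (j + 1 - q) (j + 1)) = P"
    unfolding P_def
    by (subst prod_drop_first[symmetric], simp add: padded_lower_def)
      (rule prod_drop_last, simp add: padded_lower_def)
  have "P \<noteq> 0" unfolding P_def by (simp add: padded_lower_nonzero)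
  have "skew_product (Suc t) q * skew_product t q * P =
      (\<Prod>j\<in>?J. padded (int t + j + 1) (j - q) j * padded (int t + j) (j - q) j *
        padded_lower (int t + j + 1) (j - q + 1) (j + 1))"
    unfolding drop P[symmetric] prod.distrib by (simp add: algebra_simps)
  also have "\<dots> = (\<Prod>j\<in>?J. padded_lower (int t + j) (j - q) j *
      padded (int t + j + 1) (j - q + 1) j * padded (int t + j + 1) (j - q) (j + 1))"
    \<comment> \<open>The bounds on \<open>q\<close> keep the file away from the two excluded
      corners.\<close>
    using assms by (intro prod.cong refl padded_relation) auto
  also have "\<dots> = P * skew_product (Suc t) (q - 1) * skew_product t (q + 1)"
    unfolding drop[of "Suc t" "q - 1"] drop'[of t "q + 1"] P_def prod.distrib
    by (simp add: algebra_simps)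
  finally show ?thesis using \<open>P \<noteq> 0\<close> by simp
qed

lemma skew_product_nonzero: "skew_product t q \<noteq> 0"
  by (simp add: skew_product_def padded_nonzero)

lemma skew_product_outside:
  "skew_product t (- int r - 1) = 1" "skew_product t (int s + 1) = 1"
  unfolding skew_product_def by (auto intro!: prod.neutral simp: padded_def)

text \<open>Two-step induction with \<open>n = q + r + 1\<close>. In the recurrence the stretch
  \<open>Q\<close> of consecutive terms occurs on both sides and cancels.\<close>

lemma skew_product_eq:
  assumes "n \<le> r + s + 2"
  shows "skew_product t (int n - int r - 1) = (\<Prod>m<n. skew_product (t + m) (- int r))"
  using assms
proof (induction n arbitrary: t rule: less_induct)
  case (less n)
  show ?case
  proof (cases n)
    case 0
    then show ?thesis using skew_product_outside by simp
  next
    case n: (Suc m)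
    show ?thesis
    proof (cases m)
      case 0
      then show ?thesis using n by simp
    next
      case m: (Suc l)
      define D where "D = (\<lambda>k. skew_product k (- int r))"
      define Q where "Q = (\<Prod>k<l. D (Suc t + k))"
      have "Q \<noteq> 0" by (simp add: Q_def D_def skew_product_nonzero)
      have "skew_product (Suc t) (int m - int r - 1) * skew_product t (int m - int r - 1) =
          skew_product (Suc t) (int l - int r - 1) * skew_product t (int n - int r - 1)"
        using skew_product_recurrence[of "int m - int r - 1" t] less.prems m n by (simp add: algebra_simps)
      moreover have "skew_product (Suc t) (int m - int r - 1) = Q * D (t + m)"
        using less.IH[of m "Suc t"] less.prems m n by (simp add: Q_def D_def)
      moreover have "skew_product t (int m - int r - 1) = (\<Prod>k<m. D (t + k))"
        using less.IH[of m t] less.prems n by (simp add: D_def)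
      moreover have "skew_product (Suc t) (int l - int r - 1) = Q"
        using less.IH[of l "Suc t"] less.prems m n by (simp add: Q_def D_def)
      ultimately have "Q * skew_product t (int n - int r - 1) = Q * (D (t + m) * (\<Prod>k<m. D (t + k)))"
        by (metis mult.assoc)
      then have "skew_product t (int n - int r - 1) = (\<Prod>k<n. D (t + k))"
        using \<open>Q \<noteq> 0\<close> n by (simp add: mult.commute)
      then show ?thesis by (simp add: D_def)
    qed
  qed
qed

lemma prod_skew_product:
  assumes "- int r \<le> q" "q \<le> int s"
  shows "(\<Prod>t<r + s + 2. skew_product t q) = 1"
proof -
  define n where "n = nat (q + int r + 1)"
  have q: "q = int n - int r - 1" and n: "n \<le> r + s + 2"
    using assms by (auto simp: n_def)
  \<comment> \<open>For \<open>n = r + s + 2\<close> the file is \<open>s + 1\<close>, just outside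
    the rectangle, where the product is \<open>1\<close>.\<close>
  have total: "(\<Prod>m<r + s + 2. skew_product (m + t) (- int r)) = 1" for t
    using skew_product_eq[of "r + s + 2" t] skew_product_outside(2)[of t] by (simp add: add.commute)
  have "(\<Prod>t<r + s + 2. skew_product t q) =
      (\<Prod>t<r + s + 2. \<Prod>m<n. skew_product (t + m) (- int r))"
    unfolding q using skew_product_eq[OF n] by simp
  also have "\<dots> = (\<Prod>m<n. \<Prod>t<r + s + 2. skew_product (t + m) (- int r))"
    by (rule prod.swap)
  also have "\<dots> = 1" by (simp only: total prod.neutral_const)
  finally show ?thesis .
qed

lemma prod_file_eq:
  "(\<Prod>(i, j)\<in>file_of r s q. x k i j) = (\<Prod>j\<in>{-1..int s + 1}. padded (int k) (j - q) j)"
proof -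
  have "(\<Prod>j\<in>{-1..int s + 1}. padded (int k) (j - q) j) =
      (\<Prod>j\<in>{j. 0 \<le> j - q \<and> j - q \<le> int r \<and> 0 \<le> j \<and> j \<le> int s}. padded (int k) (j - q) j)"
    by (rule prod.mono_neutral_right) (auto simp: padded_def)
  also have "\<dots> = (\<Prod>(i, j)\<in>file_of r s q. x k i j)"
    by (rule prod.reindex_bij_witness[where i = "\<lambda>(i, j). int j" and j = "\<lambda>j. (nat (j - q), nat j)"])
      (auto simp: padded_def file_of_def rect_def)
  finally show ?thesis ..
qed

text \<open>Over a full period the time may be shifted by a different amount in each row; shifting
  row \<open>j\<close> by \<open>j\<close> turns file products into skew products.\<close>

theorem prod_file_product: "(\<Prod>k<r + s + 2. \<Prod>(i, j)\<in>file_of r s q. x k i j) = 1"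
proof (cases "- int r \<le> q \<and> q \<le> int s")
  case True
  have shift: "(\<Prod>t<r + s + 2. padded (int t + j) i j) = (\<Prod>t<r + s + 2. padded (int t) i j)" for i j
  proof (cases "0 \<le> i \<and> i \<le> int r \<and> 0 \<le> j \<and> j \<le> int s")
    case True
    have nats: "nat (int t + j) = t + nat j" for t using True by (simp add: nat_add_distrib)
    show ?thesis
      using True prod_lessThan_periodic_shift[where f = "\<lambda>k. x k (nat i) (nat j)" and
          n = "r + s + 2" and c = "nat j"] periodicity[of "nat i" "nat j"]
      by (simp add: padded_def nats nat_le_iff)
  next
    case False
    then have "padded t i j = 1" for t unfolding padded_def by meson
    then show ?thesis by simp
  qed
  have "(\<Prod>k<r + s + 2. \<Prod>(i, j)\<in>file_of r s q. x k i j) =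
      (\<Prod>j\<in>{-1..int s + 1}. \<Prod>t<r + s + 2. padded (int t) (j - q) j)"
    unfolding prod_file_eq by (rule prod.swap)
  also have "\<dots> = (\<Prod>t<r + s + 2. \<Prod>j\<in>{-1..int s + 1}. padded (int t + j) (j - q) j)"
    unfolding shift[symmetric] by (rule prod.swap)
  also have "\<dots> = 1" using prod_skew_product True by (simp add: skew_product_def)
  finally show ?thesis .
next
  case False
  then have "file_of r s q = {}" by (auto simp: file_of_def rect_def)
  then show ?thesis by simp
qed

end

section \<open>Rowmotion on the rectangle\<close>

lemma bex_hat_carrier_rect:
  "(\<exists>u\<in>hat_carrier (rect r s). Q u) \<longleftrightarrow> Q Bot \<or> Q Top \<or> (\<exists>a\<le>r. \<exists>b\<le>s. Q (Elt (a, b)))"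
  by (auto simp: hat_carrier_def rect_def)

lemma Elt_in_hat_carrier_rect: "Elt (a, b) \<in> hat_carrier (rect r s) \<longleftrightarrow> a \<le> r \<and> b \<le> s"
  by (auto simp: hat_carrier_def rect_def)

lemma Pair_less_iff:
  fixes a c :: "'a::order" and b d :: "'b::order"
  shows "(a, b) < (c, d) \<longleftrightarrow> a \<le> c \<and> b \<le> d \<and> (a < c \<or> b < d)"
  by (auto simp: less_le_not_le)

lemma covered_by_rect_Bot:
  assumes "i \<le> r" "j \<le> s"
  shows "covered_by (rect r s) Bot (Elt (i, j)) \<longleftrightarrow> i = 0 \<and> j = 0"
proof -
  have "(\<exists>a\<le>r. \<exists>b\<le>s. (a, b) < (i, j)) \<longleftrightarrow> (0, 0) < (i, j)"
    using assms unfolding Pair_less_iff by (meson le_trans less_le_trans le_less_trans zero_le)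
  then show ?thesis
    using assms unfolding covered_by_def bex_hat_carrier_rect Elt_in_hat_carrier_rect
    by (simp add: hat_carrier_def Pair_less_iff)
qed

lemma covered_by_rect_Top:
  assumes "i \<le> r" "j \<le> s"
  shows "covered_by (rect r s) (Elt (i, j)) Top \<longleftrightarrow> i = r \<and> j = s"
proof -
  have "(\<exists>a\<le>r. \<exists>b\<le>s. (i, j) < (a, b)) \<longleftrightarrow> (i, j) < (r, s)"
    using assms unfolding Pair_less_iff by (meson le_trans less_le_trans le_less_trans order.refl)
  then show ?thesis
    using assms unfolding covered_by_def bex_hat_carrier_rect Elt_in_hat_carrier_rect
    by (auto simp add: hat_carrier_def Pair_less_iff)
qed

lemma covered_by_rect_Elt:
  "covered_by (rect r s) (Elt (a, b)) (Elt (c, d)) \<longleftrightarrow>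
     c \<le> r \<and> d \<le> s \<and> (c = Suc a \<and> d = b \<or> c = a \<and> d = Suc b)"
proof -
  have "covered_by (rect r s) (Elt (a, b)) (Elt (c, d)) \<longleftrightarrow> a \<le> r \<and> b \<le> s \<and> c \<le> r \<and> d \<le> s \<and>
      (a, b) < (c, d) \<and> \<not> (\<exists>a'\<le>r. \<exists>b'\<le>s. (a, b) < (a', b') \<and> (a', b') < (c, d))"
    unfolding covered_by_def bex_hat_carrier_rect Elt_in_hat_carrier_rect by simp
  also have "\<dots> \<longleftrightarrow> c \<le> r \<and> d \<le> s \<and> (c = Suc a \<and> d = b \<or> c = a \<and> d = Suc b)" (is "?l \<longleftrightarrow> ?r")
  proof
    assume l: ?l
    then have no: "\<not> ((a, b) < (a', b') \<and> (a', b') < (c, d))" if "a' \<le> r" "b' \<le> s" for a' b'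
      using that by blast
    show ?r
    proof (cases "a < c")
      case True
      then show ?thesis using no[of "Suc a" b] l by (auto simp: Pair_less_iff)
    next
      case False
      then show ?thesis using no[of a "Suc b"] l by (auto simp: Pair_less_iff)
    qed
  next
    assume ?r
    then show ?l by (auto simp: Pair_less_iff)
  qed
  finally show ?thesis .
qed

lemma covered_by_rect_lower:
  assumes "i \<le> r" "j \<le> s"
  shows "{w. covered_by (rect r s) w (Elt (i, j))} =
    (if i = 0 \<and> j = 0 then {Bot}
     else (if i = 0 then {} else {Elt (i - 1, j)}) \<union> (if j = 0 then {} else {Elt (i, j - 1)}))"
    (is "?C = ?R")
proof (intro set_eqI)
  fix w
  show "w \<in> ?C \<longleftrightarrow> w \<in> ?R"
  proof (cases w)
    case Bot
    then show ?thesis using covered_by_rect_Bot[OF assms] by simp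
  next
    case Top
    then show ?thesis by (simp add: covered_by_def)
  next
    case (Elt v)
    then show ?thesis using assms by (cases v) (auto simp: covered_by_rect_Elt)
  qed
qed

lemma covered_by_rect_upper:
  assumes "i \<le> r" "j \<le> s"
  shows "{w. covered_by (rect r s) (Elt (i, j)) w} =
    (if i = r \<and> j = s then {Top}
     else (if i = r then {} else {Elt (Suc i, j)}) \<union> (if j = s then {} else {Elt (i, Suc j)}))"
    (is "?C = ?R")
proof (intro set_eqI)
  fix w
  show "w \<in> ?C \<longleftrightarrow> w \<in> ?R"
  proof (cases w)
    case Top
    then show ?thesis using covered_by_rect_Top[OF assms] by simp
  next
    case Bot
    then show ?thesis by (simp add: covered_by_def)
  next
    case (Elt v)
    then show ?thesis using assms by (cases v) (auto simp: covered_by_rect_Elt)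
  qed
qed

lemma sum_covered_by_rect_lower:
  assumes "i \<le> r" "j \<le> s" "f Bot = 1"
  shows "(\<Sum>w | covered_by (rect r s) w (Elt (i, j)). f w) = lower_sum (\<lambda>i j. f (Elt (i, j))) i j"
  using assms by (auto simp: covered_by_rect_lower lower_sum_def sum.insert_if)

lemma sum_covered_by_rect_upper:
  assumes "i \<le> r" "j \<le> s" "f Top = 1"
  shows "(\<Sum>z | covered_by (rect r s) (Elt (i, j)) z. 1 / f z) = upper_sum r s (\<lambda>i j. f (Elt (i, j))) i j"
  using assms by (auto simp: covered_by_rect_upper upper_sum_def sum.insert_if)

section \<open>From toggles to the toggle relation\<close>

lemma covered_by_hat_less: "covered_by P w v \<Longrightarrow> hat_less w v"
  by (simp add: covered_by_def)

lemma foldr_toggle_other: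
  assumes "\<And>v. v \<in> set vs \<Longrightarrow> w \<noteq> Elt v"
  shows "foldr (toggle P) vs f w = f w"
  using assms by (induction vs) (auto simp: toggle_def)

lemma birational_rowmotion_bounds [simp]:
  "birational_rowmotion P vs f Bot = f Bot" "birational_rowmotion P vs f Top = f Top"
  by (simp_all add: birational_rowmotion_def foldr_toggle_other)

lemma rowmotion_defined_append:
  "rowmotion_defined P (us @ ws) f \<longleftrightarrow>
     rowmotion_defined P ws f \<and> rowmotion_defined P us (birational_rowmotion P ws f)"
  by (induction us) (auto simp: birational_rowmotion_def)

text \<open>
  When \<open>v\<close> is toggled, all elements above it have been toggled already and none below it has.
\<close>

lemma rowmotion_step:
  fixes f :: "'a::order hat \<Rightarrow> 'k::field"
  assumes ext: "linear_extension P vs" and v: "v \<in> P" and "rowmotion_defined P vs f"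
  defines "f' \<equiv> birational_rowmotion P vs f"
  shows "f (Elt v) \<noteq> 0"
    and "(\<Sum>z | covered_by P (Elt v) z. 1 / f' z) \<noteq> 0"
    and "f' (Elt v) * f (Elt v) * (\<Sum>z | covered_by P (Elt v) z. 1 / f' z) =
      (\<Sum>w | covered_by P w (Elt v). f w)"
proof -
  obtain us ws where vs: "vs = us @ v # ws"
    using ext v by (auto simp: linear_extension_def dest: split_list)
  have dist: "v \<notin> set us" "v \<notin> set ws" "distinct vs"
    using ext by (auto simp: linear_extension_def vs)
  have order: "i < j" if "i < length vs" "j < length vs" "vs ! i < vs ! j" for i j
    using ext that by (auto simp: linear_extension_def)
  have below: "\<not> v < u" if u: "u \<in> set us" for u
  proof
    assume "v < u"
    obtain k where k: "k < length us" "us ! k = u" using u by (auto simp: in_set_conv_nth)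
    then show False using order[of "length us" k] \<open>v < u\<close> by (simp add: vs nth_append)
  qed
  have above: "\<not> u < v" if u: "u \<in> set ws" for u
  proof
    assume "u < v"
    obtain k where k: "k < length ws" "ws ! k = u" using u by (auto simp: in_set_conv_nth)
    then show False
      using order[of "Suc (length us + k)" "length us"] \<open>u < v\<close> by (simp add: vs nth_append)
  qed
  \<comment> \<open>The labeling at the moment when \<open>v\<close> is toggled:
    \<open>foldr\<close> has processed \<open>ws\<close> but not yet \<open>us\<close>.\<close>
  define g where "g = birational_rowmotion P ws f"
  have f': "f' = foldr (toggle P) us (toggle P v g)"
    by (simp add: f'_def birational_rowmotion_def vs g_def)
  have "toggle_defined P v g"
    using assms(3) by (simp add: vs rowmotion_defined_append g_def)
  moreover have fv: "g (Elt v) = f (Elt v)"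
    unfolding g_def birational_rowmotion_def using dist by (intro foldr_toggle_other) auto
  moreover have upper: "(\<Sum>z | covered_by P (Elt v) z. 1 / g z) = (\<Sum>z | covered_by P (Elt v) z. 1 / f' z)"
  proof (rule sum.cong)
    fix z assume "z \<in> {z. covered_by P (Elt v) z}"
    then have z: "hat_less (Elt v) z" by (simp add: covered_by_hat_less)
    have "f' z = toggle P v g z"
      unfolding f' using z below by (intro foldr_toggle_other) auto
    also have "\<dots> = g z" using z by (auto simp: toggle_def)
    finally show "1 / g z = 1 / f' z" by simp
  qed simp
  ultimately show nz: "f (Elt v) \<noteq> 0" and up: "(\<Sum>z | covered_by P (Elt v) z. 1 / f' z) \<noteq> 0"
    by (auto simp: toggle_defined_def)
  have lower: "(\<Sum>w | covered_by P w (Elt v). g w) = (\<Sum>w | covered_by P w (Elt v). f w)"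
  proof (rule sum.cong)
    fix w assume "w \<in> {w. covered_by P w (Elt v)}"
    then have w: "hat_less w (Elt v)" by (simp add: covered_by_hat_less)
    show "g w = f w"
      unfolding g_def birational_rowmotion_def using w above by (intro foldr_toggle_other) auto
  qed simp
  have "f' (Elt v) = toggle P v g (Elt v)"
    unfolding f' using dist by (intro foldr_toggle_other) auto
  then show "f' (Elt v) * f (Elt v) * (\<Sum>z | covered_by P (Elt v) z. 1 / f' z) =
      (\<Sum>w | covered_by P w (Elt v). f w)"
    using nz up by (simp add: toggle_def fv lower upper)
qed

lemma rowmotion_orbit_rect:
  fixes f :: "(nat \<times> nat) hat \<Rightarrow> 'k::field"
  assumes ext: "linear_extension (rect r s) vs" and f: "f \<in> rowmotion_labelings (rect r s) vs"
  shows "rowmotion_orbit r s (\<lambda>k i j. (birational_rowmotion (rect r s) vs ^^ k) f (Elt (i, j)))"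
proof -
  let ?F = "\<lambda>k. (birational_rowmotion (rect r s) vs ^^ k) f"
  have bounds: "?F k Bot = 1" "?F k Top = 1" for k
    using f by (induction k) (auto simp: rowmotion_labelings_def)
  have defined: "rowmotion_defined (rect r s) vs (?F k)" for k
    using f by (auto simp: rowmotion_labelings_def)
  let ?x = "\<lambda>k i j. ?F k (Elt (i, j))"
  have step: "?x k i j \<noteq> 0" "upper_sum r s (?x (Suc k)) i j \<noteq> 0"
    "?x (Suc k) i j * ?x k i j * upper_sum r s (?x (Suc k)) i j = lower_sum (?x k) i j"
    if "i \<le> r" "j \<le> s" for i j k
    using rowmotion_step[OF ext _ defined[of k], of "(i, j)"] that bounds[of k] bounds[of "Suc k"]
      sum_covered_by_rect_upper[OF that, of "?F (Suc k)"] sum_covered_by_rect_lower[OF that, of "?F k"]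
    by (simp_all add: rect_def)
  show ?thesis
  proof (unfold_locales)
    fix i j k assume ij: "i \<le> r" "j \<le> s"
    show "?x k i j \<noteq> 0"
      using step(1)[OF ij] .
    show "lower_sum (?x k) i j \<noteq> 0"
      \<comment> \<open>The toggle relation writes the lower sum as a product of three nonzero
        factors.\<close>
      using step(1)[OF ij, of k] step(1)[OF ij, of "Suc k"] step(2)[OF ij, of k]
        step(3)[OF ij, of k] by (metis mult_eq_0_iff)
    show "?x (Suc k) i j * ?x k i j * upper_sum r s (?x (Suc k)) i j = lower_sum (?x k) i j"
      using step(3)[OF ij] .
  qed
qed

section \<open>Substitution in rational functions\<close>

locale ring_morphism =
  fixes \<phi> :: "'a::comm_ring_1 \<Rightarrow> 'b::comm_ring_1"
  assumes one: "\<phi> 1 = 1" and add: "\<phi> (a + b) = \<phi> a + \<phi> b" and mult: "\<phi> (a * b) = \<phi> a * \<phi> b"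
begin

lemma zero: "\<phi> 0 = 0"
  using add[of 0 0] by simp

lemma sum: "\<phi> (\<Sum>x\<in>A. f x) = (\<Sum>x\<in>A. \<phi> (f x))"
  by (induction A rule: infinite_finite_induct) (simp_all add: zero add)

end

lemma ring_morphism_comp:
  assumes "ring_morphism \<phi>" "ring_morphism \<psi>"
  shows "ring_morphism (\<phi> \<circ> \<psi>)"
proof -
  interpret \<phi>: ring_morphism \<phi> by fact
  interpret \<psi>: ring_morphism \<psi> by fact
  show ?thesis by unfold_locales (simp_all add: \<phi>.one \<psi>.one \<phi>.add \<psi>.add \<phi>.mult \<psi>.mult)
qed

locale field_morphism = ring_morphism \<phi> for \<phi> :: "'a::field \<Rightarrow> 'b::field"
begin

lemma eq_0_iff: "\<phi> a = 0 \<longleftrightarrow> a = 0"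
proof
  assume "\<phi> a = 0"
  show "a = 0"
  proof (rule ccontr)
    assume "a \<noteq> 0"
    then show False using mult[of a "inverse a"] \<open>\<phi> a = 0\<close> by (simp add: one)
  qed
qed (simp add: zero)

lemma divide: "\<phi> (a / b) = \<phi> a / \<phi> b"
proof (cases "b = 0")
  case True
  then show ?thesis by (simp add: zero)
next
  case False
  then show ?thesis using mult[of "a / b" b] eq_0_iff[of b] by (simp add: field_simps)
qed

text \<open>A toggle is built from field operations, and \<open>1 / 0 = 0\<close> is preserved too.
  Facts about the generic labeling thus pass to its images under field morphisms.\<close>

lemma toggle: "toggle P v (\<phi> \<circ> f) = \<phi> \<circ> toggle P v f"
  by (auto simp: toggle_def sum mult divide one fun_eq_iff)

lemma toggle_defined: "toggle_defined P v (\<phi> \<circ> f) \<longleftrightarrow> toggle_defined P v f"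
proof -
  have "(\<Sum>z | covered_by P (Elt v) z. 1 / (\<phi> \<circ> f) z) = \<phi> (\<Sum>z | covered_by P (Elt v) z. 1 / f z)"
    by (simp add: sum divide one)
  then show ?thesis unfolding toggle_defined_def by (simp add: eq_0_iff)
qed

end

section \<open>Evaluation of polynomials and its extension to fractions\<close>

definition monomial_eval :: "(nat \<Rightarrow> 'a::comm_ring_1) \<Rightarrow> (nat \<Rightarrow>\<^sub>0 nat) \<Rightarrow> 'a" where
  "monomial_eval f m = (\<Prod>i\<in>Poly_Mapping.keys m. f i ^ Poly_Mapping.lookup m i)"

definition mpoly_eval ::
    "('k::comm_ring_1 \<Rightarrow> 'a::comm_ring_1) \<Rightarrow> (nat \<Rightarrow> 'a) \<Rightarrow> ((nat \<Rightarrow>\<^sub>0 nat) \<Rightarrow>\<^sub>0 'k) \<Rightarrow> 'a" where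
  "mpoly_eval c f p = (\<Sum>m\<in>Poly_Mapping.keys p. c (Poly_Mapping.lookup p m) * monomial_eval f m)"

lemma monomial_eval_superset:
  assumes "finite S" "Poly_Mapping.keys m \<subseteq> S"
  shows "monomial_eval f m = (\<Prod>i\<in>S. f i ^ Poly_Mapping.lookup m i)"
  unfolding monomial_eval_def using assms
  by (intro prod.mono_neutral_left) (auto simp: in_keys_iff)

lemma monomial_eval_zero [simp]: "monomial_eval f 0 = 1"
  by (simp add: monomial_eval_def)

lemma monomial_eval_single: "monomial_eval f (Poly_Mapping.single i 1) = f i"
  by (simp add: monomial_eval_def)

lemma monomial_eval_add: "monomial_eval f (m + n) = monomial_eval f m * monomial_eval f n"
proof -
  let ?S = "Poly_Mapping.keys m \<union> Poly_Mapping.keys n"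
  have "monomial_eval f (m + n) = (\<Prod>i\<in>?S. f i ^ Poly_Mapping.lookup (m + n) i)"
    by (rule monomial_eval_superset) (simp_all add: Poly_Mapping.keys_add)
  then show ?thesis
    by (simp add: monomial_eval_superset[of ?S m] monomial_eval_superset[of ?S n]
        lookup_add power_add prod.distrib)
qed

lemma sum_single_lookup: "(\<Sum>m\<in>Poly_Mapping.keys p. Poly_Mapping.single m (Poly_Mapping.lookup p m)) = p"
proof (rule poly_mapping_eqI)
  fix k
  have "Poly_Mapping.lookup (\<Sum>m\<in>Poly_Mapping.keys p. Poly_Mapping.single m (Poly_Mapping.lookup p m)) k =
      (\<Sum>m\<in>Poly_Mapping.keys p. if m = k then Poly_Mapping.lookup p m else 0)"
    by (simp add: lookup_sum lookup_single when_def)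
  also have "\<dots> = Poly_Mapping.lookup p k"
    by (simp add: in_keys_iff)
  finally show "Poly_Mapping.lookup (\<Sum>m\<in>Poly_Mapping.keys p. Poly_Mapping.single m (Poly_Mapping.lookup p m)) k = Poly_Mapping.lookup p k" .
qed

lemma ring_morphism_mpoly_eval:
  fixes c :: "'k::comm_ring_1 \<Rightarrow> 'a::comm_ring_1"
  assumes "ring_morphism c"
  shows "ring_morphism (mpoly_eval c f)"
    and "mpoly_eval c f (Poly_Mapping.single m a) = c a * monomial_eval f m"
proof -
  interpret c: ring_morphism c by fact
  \<comment> \<open>Keys may cancel in a sum; a common finite superset lets all sums run over one
    index set.\<close>
  have superset: "mpoly_eval c f p = (\<Sum>m\<in>S. c (Poly_Mapping.lookup p m) * monomial_eval f m)"
    if "finite S" "Poly_Mapping.keys p \<subseteq> S" for p S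
    unfolding mpoly_eval_def using that
    by (intro sum.mono_neutral_left) (auto simp: in_keys_iff c.zero)
  show single: "mpoly_eval c f (Poly_Mapping.single m a) = c a * monomial_eval f m" for m a
    by (subst superset[of "{m}"]) auto
  have plus: "mpoly_eval c f (p + q) = mpoly_eval c f p + mpoly_eval c f q" for p q
  proof -
    let ?S = "Poly_Mapping.keys p \<union> Poly_Mapping.keys q"
    have "mpoly_eval c f (p + q) = (\<Sum>m\<in>?S. c (Poly_Mapping.lookup (p + q) m) * monomial_eval f m)"
      by (rule superset) (simp_all add: Poly_Mapping.keys_add)
    then show ?thesis
      by (simp add: superset[of ?S p] superset[of ?S q] lookup_add c.add sum.distrib distrib_right)
  qed
  have zero: "mpoly_eval c f 0 = 0" by (simp add: mpoly_eval_def)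
  have sum: "mpoly_eval c f (\<Sum>x\<in>A. g x) = (\<Sum>x\<in>A. mpoly_eval c f (g x))"
    for A :: "(nat \<Rightarrow>\<^sub>0 nat) set" and g
    by (induction A rule: infinite_finite_induct) (simp_all add: zero plus)
  show "ring_morphism (mpoly_eval c f)"
  proof
    show "mpoly_eval c f 1 = 1"
      using single[of 0 1] by (simp add: c.one)
    fix p q :: "(nat \<Rightarrow>\<^sub>0 nat) \<Rightarrow>\<^sub>0 'k"
    let ?P = "Poly_Mapping.keys p" and ?Q = "Poly_Mapping.keys q"
    have "p * q = (\<Sum>m\<in>?P. Poly_Mapping.single m (Poly_Mapping.lookup p m)) * (\<Sum>n\<in>?Q. Poly_Mapping.single n (Poly_Mapping.lookup q n))"
      by (simp only: sum_single_lookup)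
    also have "\<dots> = (\<Sum>m\<in>?P. \<Sum>n\<in>?Q. Poly_Mapping.single (m + n) (Poly_Mapping.lookup p m * Poly_Mapping.lookup q n))"
      by (simp add: sum_product mult_single)
    also have "mpoly_eval c f \<dots> = (\<Sum>m\<in>?P. \<Sum>n\<in>?Q.
        (c (Poly_Mapping.lookup p m) * monomial_eval f m) * (c (Poly_Mapping.lookup q n) * monomial_eval f n))"
      by (simp add: sum single monomial_eval_add c.mult mult_ac)
    also have "\<dots> = mpoly_eval c f p * mpoly_eval c f q"
      by (simp add: mpoly_eval_def sum_product)
    finally show "mpoly_eval c f (p * q) = mpoly_eval c f p * mpoly_eval c f q" .
  qed (rule plus)
qed

text \<open>The value does not depend on the representative once \<phi> is a morphism with trivial
  kernel, as the following lemmas assume.\<close>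

definition fract_lift :: "('a::idom \<Rightarrow> 'b::field) \<Rightarrow> 'a fract \<Rightarrow> 'b" where
  "fract_lift \<phi> z = (THE b. \<exists>p q. z = Fract p q \<and> q \<noteq> 0 \<and> b = \<phi> p / \<phi> q)"

context
  fixes \<phi> :: "'a::idom \<Rightarrow> 'b::field"
  assumes morphism: "ring_morphism \<phi>" and inj: "\<And>p. \<phi> p = 0 \<Longrightarrow> p = 0"
begin

interpretation ring_morphism \<phi> by (rule morphism)

lemma fract_lift_Fract:
  assumes "q \<noteq> 0"
  shows "fract_lift \<phi> (Fract p q) = \<phi> p / \<phi> q"
  unfolding fract_lift_def
proof (rule the_equality)
  show "\<exists>p' q'. Fract p q = Fract p' q' \<and> q' \<noteq> 0 \<and> \<phi> p / \<phi> q = \<phi> p' / \<phi> q'"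
    using assms by blast
  fix b assume "\<exists>p' q'. Fract p q = Fract p' q' \<and> q' \<noteq> 0 \<and> b = \<phi> p' / \<phi> q'"
  then obtain p' q' where *: "Fract p q = Fract p' q'" "q' \<noteq> 0" "b = \<phi> p' / \<phi> q'"
    by blast
  then have "\<phi> (p * q') = \<phi> (p' * q)" using assms by (simp add: eq_fract)
  moreover have "\<phi> q \<noteq> 0" "\<phi> q' \<noteq> 0" using inj assms * by blast+
  ultimately show "b = \<phi> p / \<phi> q" using * by (simp add: mult frac_eq_eq)
qed

lemma field_morphism_fract_lift: "field_morphism (fract_lift \<phi>)"
proof -
  have nz: "q \<noteq> 0 \<Longrightarrow> \<phi> q \<noteq> 0" for q using inj by blast
  have "fract_lift \<phi> (y + z) = fract_lift \<phi> y + fract_lift \<phi> z" for y z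
  proof (cases y; cases z)
    fix a b c d assume "y = Fract a b" "b \<noteq> 0" "z = Fract c d" "d \<noteq> 0"
    then show ?thesis using nz[of b] nz[of d] by (simp add: fract_lift_Fract add mult field_simps)
  qed
  moreover have "fract_lift \<phi> (y * z) = fract_lift \<phi> y * fract_lift \<phi> z" for y z
  proof (cases y; cases z)
    fix a b c d assume "y = Fract a b" "b \<noteq> 0" "z = Fract c d" "d \<noteq> 0"
    then show ?thesis by (simp add: fract_lift_Fract mult)
  qed
  moreover have "fract_lift \<phi> 1 = 1"
    by (simp add: One_fract_def fract_lift_Fract one)
  ultimately show ?thesis
    by (simp add: field_morphism_def ring_morphism_def)
qed

end

text \<open>
  The substitution \<open>z \<mapsto> z(\<phi>)\<close> as a partial map: it is defined on the fractions with a
  denominator that \<open>\<phi>\<close> does not annihilate.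
\<close>

definition subst_rel :: "('a::idom \<Rightarrow> 'b::field) \<Rightarrow> 'a fract \<Rightarrow> 'b \<Rightarrow> bool" where
  "subst_rel \<phi> z b \<longleftrightarrow> (\<exists>p q. z = Fract p q \<and> \<phi> q \<noteq> 0 \<and> b = \<phi> p / \<phi> q)"

context
  fixes \<phi> :: "'a::idom \<Rightarrow> 'b::field"
  assumes morphism: "ring_morphism \<phi>"
begin

interpretation ring_morphism \<phi> by (rule morphism)

lemma subst_rel_Fract: "subst_rel \<phi> (Fract p 1) (\<phi> p)"
  unfolding subst_rel_def by (intro exI[of _ p] exI[of _ 1]) (simp add: one)

lemma subst_rel_one: "subst_rel \<phi> 1 1"
  using subst_rel_Fract[of 1] by (simp add: One_fract_def one)

text \<open>The instance of single-valuedness from which injectivity of the toggle substitution is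
  deduced.\<close>

lemma subst_rel_zeroD:
  assumes "subst_rel \<phi> 0 b"
  shows "b = 0"
proof -
  obtain p q where *: "0 = Fract p q" "\<phi> q \<noteq> 0" "b = \<phi> p / \<phi> q"
    using assms by (auto simp: subst_rel_def)
  then have "q \<noteq> 0" using zero by auto
  then have "p = 0" using *(1) by (simp add: Zero_fract_def eq_fract)
  then show ?thesis using * by (simp add: zero)
qed

lemma subst_rel_zero: "subst_rel \<phi> 0 0"
  using subst_rel_Fract[of 0] by (simp add: Zero_fract_def zero)

lemma subst_rel_add:
  assumes "subst_rel \<phi> y b" "subst_rel \<phi> z c"
  shows "subst_rel \<phi> (y + z) (b + c)"
proof -
  obtain p q p' q' where *: "y = Fract p q" "\<phi> q \<noteq> 0" "b = \<phi> p / \<phi> q"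
      "z = Fract p' q'" "\<phi> q' \<noteq> 0" "c = \<phi> p' / \<phi> q'"
    using assms by (auto simp: subst_rel_def)
  then have "q \<noteq> 0" "q' \<noteq> 0" using zero by auto
  then show ?thesis
    unfolding subst_rel_def using *
    by (intro exI[of _ "p * q' + p' * q"] exI[of _ "q * q'"]) (simp add: mult add field_simps)
qed

lemma subst_rel_mult:
  assumes "subst_rel \<phi> y b" "subst_rel \<phi> z c"
  shows "subst_rel \<phi> (y * z) (b * c)"
proof -
  obtain p q p' q' where *: "y = Fract p q" "\<phi> q \<noteq> 0" "b = \<phi> p / \<phi> q"
      "z = Fract p' q'" "\<phi> q' \<noteq> 0" "c = \<phi> p' / \<phi> q'"
    using assms by (auto simp: subst_rel_def)
  then show ?thesis
    unfolding subst_rel_def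
    by (intro exI[of _ "p * p'"] exI[of _ "q * q'"]) (simp add: mult)
qed

lemma subst_rel_divide:
  assumes "subst_rel \<phi> y b" "subst_rel \<phi> z c" "c \<noteq> 0"
  shows "subst_rel \<phi> (y / z) (b / c)"
proof -
  obtain p q where *: "z = Fract p q" "\<phi> q \<noteq> 0" "c = \<phi> p / \<phi> q"
    using assms by (auto simp: subst_rel_def)
  then have "subst_rel \<phi> (inverse z) (inverse c)"
    unfolding subst_rel_def using assms(3)
    by (intro exI[of _ q] exI[of _ p]) auto
  then show ?thesis
    using subst_rel_mult[OF assms(1)] by (simp add: divide_inverse)
qed

lemma subst_rel_sum:
  "(\<And>x. x \<in> A \<Longrightarrow> subst_rel \<phi> (f x) (g x)) \<Longrightarrow> subst_rel \<phi> (\<Sum>x\<in>A. f x) (\<Sum>x\<in>A. g x)"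
  by (induction A rule: infinite_finite_induct) (auto simp: subst_rel_zero subst_rel_add)

lemma subst_rel_prod:
  "(\<And>x. x \<in> A \<Longrightarrow> subst_rel \<phi> (f x) (g x)) \<Longrightarrow> subst_rel \<phi> (\<Prod>x\<in>A. f x) (\<Prod>x\<in>A. g x)"
  by (induction A rule: infinite_finite_induct) (auto simp: subst_rel_one subst_rel_mult)

lemma subst_rel_power: "subst_rel \<phi> y b \<Longrightarrow> subst_rel \<phi> (y ^ n) (b ^ n)"
  by (induction n) (auto simp: subst_rel_one subst_rel_mult)

end

definition ratfun_const :: "'k::field \<Rightarrow> 'k ratfun" where
  "ratfun_const a = Fract (Poly_Mapping.single 0 a) 1"

lemma ring_morphism_ratfun_const: "ring_morphism ratfun_const"
  by unfold_locales (simp_all add: ratfun_const_def single_add mult_single One_fract_def)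

lemma ring_morphism_Fract: "ring_morphism (\<lambda>p::'a::idom. Fract p 1)"
  by unfold_locales (simp_all add: One_fract_def)

lemma mpoly_eval_indets:
  fixes p :: "(nat \<Rightarrow>\<^sub>0 nat) \<Rightarrow>\<^sub>0 'k::field"
  shows "mpoly_eval ratfun_const (\<lambda>i. indet (prod_decode i)) p = Fract p 1"
proof -
  interpret F: ring_morphism "\<lambda>p::(nat \<Rightarrow>\<^sub>0 nat) \<Rightarrow>\<^sub>0 'k. Fract p 1" by (rule ring_morphism_Fract)
  have power: "indet (prod_decode i) ^ n = (Fract (Poly_Mapping.single (Poly_Mapping.single i n) 1) 1 :: 'k ratfun)" for i n
    by (induction n) (simp_all add: indet_def One_fract_def mult_single flip: single_add)
  have prod: "(\<Prod>i\<in>S. Fract (Poly_Mapping.single (Poly_Mapping.single i (e i)) 1) 1) =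
      (Fract (Poly_Mapping.single (\<Sum>i\<in>S. Poly_Mapping.single i (e i)) 1) 1 :: 'k ratfun)" for S e
    by (induction S rule: infinite_finite_induct) (simp_all add: One_fract_def mult_single)
  have "mpoly_eval ratfun_const (\<lambda>i. indet (prod_decode i)) p =
      (\<Sum>m\<in>Poly_Mapping.keys p. Fract (Poly_Mapping.single m (Poly_Mapping.lookup p m)) 1)"
    by (simp add: mpoly_eval_def monomial_eval_def power prod sum_single_lookup ratfun_const_def mult_single)
  also have "\<dots> = Fract p 1"
    by (simp only: sum_single_lookup flip: F.sum)
  finally show ?thesis .
qed

section \<open>The generic labeling\<close>

lemma single_eq_0_iff: "Poly_Mapping.single k a = 0 \<longleftrightarrow> a = 0"
  by (metis lookup_single_eq lookup_zero single_zero)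

lemma indet_nonzero: "indet v \<noteq> 0"
  by (simp add: indet_def Zero_fract_def eq_fract single_eq_0_iff)

text \<open>The two monomials are distinct, so one of them keeps coefficient \<open>1\<close>; this
  covers characteristic 2 as well.\<close>

lemma indet_add_nonzero:
  assumes "v \<noteq> w"
  shows "indet v + indet w \<noteq> (0 :: 'k::field ratfun)"
proof
  let ?m = "\<lambda>v. Poly_Mapping.single (prod_encode v) (1::nat)"
  let ?X = "\<lambda>v. Poly_Mapping.single (?m v) (1::'k)"
  assume "indet v + indet w = (0 :: 'k ratfun)"
  then have "?X v + ?X w = 0"
    by (simp add: indet_def Zero_fract_def eq_fract)
  then have "Poly_Mapping.lookup (?X v + ?X w) (?m v) = 0" by simp
  moreover have "?m w \<noteq> ?m v"
    using assms by (metis lookup_single_eq lookup_single_not_eq prod_encode_eq zero_neq_one)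
  ultimately show False by (simp add: lookup_add lookup_single_not_eq)
qed

lemma rectangle_labeling_indet: "rectangle_labeling r s (\<lambda>i j. indet (i, j) :: 'k::field ratfun)"
  by unfold_locales (auto simp: lower_sum_def indet_nonzero indet_add_nonzero)

text \<open>
  Toggling is an involution, so substituting the labels \<open>f\<close> of the toggled generic labeling
  into themselves returns the indeterminates. A polynomial annihilated by \<open>f\<close> therefore vanishes.
\<close>

lemma toggle_substitution:
  assumes v: "v \<in> rect r s"
  obtains \<sigma> :: "'k::field ratfun \<Rightarrow> 'k ratfun"
    where "field_morphism \<sigma>" "toggle (rect r s) v generic_labeling = \<sigma> \<circ> generic_labeling"
      "toggle_defined (rect r s) v (generic_labeling :: _ \<Rightarrow> 'k ratfun)"
proof -
  let ?P = "rect r s"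
  let ?X = "generic_labeling :: _ \<Rightarrow> 'k ratfun"
  define f where "f = toggle ?P v ?X"
  define lo where "lo = (\<Sum>w | covered_by ?P w (Elt v). ?X w)"
  define up where "up = (\<Sum>z | covered_by ?P (Elt v) z. 1 / ?X z)"
  obtain i j where ij: "v = (i, j)" "i \<le> r" "j \<le> s" using v by (auto simp: rect_def)
  interpret X: rectangle_labeling r s "\<lambda>i j. indet (i, j) :: 'k ratfun"
    by (rule rectangle_labeling_indet)
  have nz: "lo \<noteq> 0" "up \<noteq> 0"
    using X.lower_sum_nonzero[OF ij(2,3)] X.upper_sum_nonzero[OF ij(2,3)] ij
    by (simp_all add: lo_def up_def sum_covered_by_rect_lower sum_covered_by_rect_upper)
  have X_nz: "?X w \<noteq> 0" for w by (cases w) (simp_all add: indet_nonzero)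
  have f_v: "f (Elt v) = 1 / ?X (Elt v) * (lo / up)"
    by (simp add: f_def toggle_def lo_def up_def)
  have f_other: "f w = ?X w" if "w \<noteq> Elt v" for w
    using that by (simp add: f_def toggle_def)
  define c where "c = (ratfun_const :: 'k \<Rightarrow> 'k ratfun)"
  define \<phi> where "\<phi> = mpoly_eval c (\<lambda>n. f (Elt (prod_decode n)))"
  have c: "ring_morphism c" unfolding c_def by (rule ring_morphism_ratfun_const)
  have \<phi>: "ring_morphism \<phi>" unfolding \<phi>_def by (rule ring_morphism_mpoly_eval(1)[OF c])
  note subst = subst_rel_add[OF \<phi>] subst_rel_mult[OF \<phi>] subst_rel_divide[OF \<phi>]
    subst_rel_sum[OF \<phi>] subst_rel_prod[OF \<phi>] subst_rel_power[OF \<phi>] subst_rel_one[OF \<phi>]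
  have \<phi>_indet: "\<phi> (Poly_Mapping.single (Poly_Mapping.single (prod_encode w) 1) 1) = f (Elt w)" for w
    unfolding \<phi>_def ring_morphism_mpoly_eval(2)[OF c]
    by (simp only: ring_morphism.one[OF c] monomial_eval_single prod_encode_inverse mult_1)
  have subst_X: "subst_rel \<phi> (?X w) (f w)" for w
  proof (cases w)
    case (Elt u)
    then show ?thesis
      using subst_rel_Fract[OF \<phi>] \<phi>_indet[of u] by (metis generic_labeling.simps(2) indet_def)
  qed (simp_all add: f_other subst)
  have subst_other: "subst_rel \<phi> (?X w) (?X w)" if "w \<noteq> Elt v" for w
    using subst_X[of w] f_other[OF that] by simp
  \<comment> \<open>No neighbour of \<open>v\<close> is \<open>v\<close> itself, and elsewhere
    \<open>f\<close> agrees with the generic labeling; so the substitution fixes \<open>lo\<close>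
    and \<open>up\<close>.\<close>
  have "subst_rel \<phi> lo lo"
    unfolding lo_def by (intro subst subst_other) (auto dest: covered_by_hat_less)
  moreover have "subst_rel \<phi> up up"
    unfolding up_def by (intro subst subst_other) (auto dest: covered_by_hat_less simp: X_nz)
  \<comment> \<open>Substituting into the new label at \<open>v\<close> amounts to toggling a second
    time, which restores the indeterminate.\<close>
  ultimately have "subst_rel \<phi> (f (Elt v)) (1 / f (Elt v) * (lo / up))"
    unfolding f_v using nz X_nz[of "Elt v"] subst_X[of "Elt v", unfolded f_v]
    by (intro subst) auto
  also have "1 / f (Elt v) * (lo / up) = ?X (Elt v)"
    unfolding f_v using nz X_nz[of "Elt v"] by (simp add: field_simps)
  finally have subst_f: "subst_rel \<phi> (f w) (?X w)" for w
    using subst_other[of w] f_other[of w] by (cases "w = Elt v") simp_all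
  have subst_const: "subst_rel \<phi> (c a) (c a)" for a
  proof -
    have "\<phi> (Poly_Mapping.single 0 a) = c a"
      unfolding \<phi>_def ring_morphism_mpoly_eval(2)[OF c] by simp
    then show ?thesis
      using subst_rel_Fract[OF \<phi>, of "Poly_Mapping.single 0 a"] by (simp add: c_def ratfun_const_def)
  qed
  \<comment> \<open>Substituting twice returns \<open>p\<close>. The relation
    \<open>subst_rel\<close> makes sense before \<phi> is known to be injective, which avoids a
    circle with \<open>fract_lift\<close>.\<close>
  have subst_\<phi>: "subst_rel \<phi> (\<phi> p) (Fract p 1)" for p
  proof -
    have "subst_rel \<phi> (\<phi> p) (mpoly_eval c (\<lambda>n. ?X (Elt (prod_decode n))) p)"
      unfolding \<phi>_def[THEN fun_cong, of p] mpoly_eval_def monomial_eval_def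
      by (intro subst subst_const subst_f)
    then show ?thesis by (simp add: c_def mpoly_eval_indets)
  qed
  have inj: "p = 0" if "\<phi> p = 0" for p
  proof -
    have "Fract p 1 = 0" using subst_rel_zeroD[OF \<phi>] subst_\<phi>[of p] that by simp
    then show ?thesis by (simp add: Zero_fract_def eq_fract)
  qed
  show ?thesis
  proof (rule that)
    show "field_morphism (fract_lift \<phi>)"
      by (rule field_morphism_fract_lift[OF \<phi> inj])
    have "fract_lift \<phi> (Fract p 1) = \<phi> p" for p
      by (simp add: fract_lift_Fract[OF \<phi> inj] ring_morphism.one[OF \<phi>])
    then have "f w = fract_lift \<phi> (?X w)" for w
      using \<phi>_indet ring_morphism.one[OF \<phi>]
      by (cases w) (simp_all add: f_other indet_def One_fract_def)
    then show "toggle ?P v ?X = fract_lift \<phi> \<circ> ?X"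
      by (auto simp: f_def)
    show "toggle_defined ?P v ?X"
      using nz X_nz by (simp add: toggle_defined_def up_def indet_nonzero)
  qed
qed

definition generic :: "((nat \<times> nat) hat \<Rightarrow> 'k::field ratfun) \<Rightarrow> bool" where
  "generic f \<longleftrightarrow> (\<exists>\<sigma> :: 'k ratfun \<Rightarrow> 'k ratfun. field_morphism \<sigma> \<and> f = \<sigma> \<circ> generic_labeling)"

text \<open>Toggles commute with \<open>\<sigma>\<close>, so toggling \<open>f\<close> composes
  \<open>\<sigma>\<close> with the endomorphism that represents the toggled generic
  labeling.\<close>

lemma generic_toggle:
  fixes f :: "(nat \<times> nat) hat \<Rightarrow> 'k::field ratfun"
  assumes "generic f" "v \<in> rect r s"
  shows "toggle_defined (rect r s) v f" "generic (toggle (rect r s) v f)"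
proof -
  obtain \<sigma> :: "'k ratfun \<Rightarrow> 'k ratfun" where \<sigma>: "field_morphism \<sigma>" "f = \<sigma> \<circ> generic_labeling"
    using assms(1) by (auto simp: generic_def)
  obtain \<tau> :: "'k ratfun \<Rightarrow> 'k ratfun" where \<tau>: "field_morphism \<tau>"
    "toggle (rect r s) v generic_labeling = \<tau> \<circ> generic_labeling"
    "toggle_defined (rect r s) v (generic_labeling :: _ \<Rightarrow> 'k ratfun)"
    using toggle_substitution[OF assms(2)] by metis
  interpret \<sigma>: field_morphism \<sigma> by fact
  show "toggle_defined (rect r s) v f"
    using \<tau>(3) by (simp add: \<sigma>(2) \<sigma>.toggle_defined)
  have "toggle (rect r s) v f = (\<sigma> \<circ> \<tau>) \<circ> generic_labeling"
    by (simp add: \<sigma>(2) \<sigma>.toggle \<tau>(2) comp_assoc)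
  moreover have "field_morphism (\<sigma> \<circ> \<tau>)"
    using ring_morphism_comp \<sigma>(1) \<tau>(1) unfolding field_morphism_def by blast
  ultimately show "generic (toggle (rect r s) v f)"
    unfolding generic_def by blast
qed

lemma generic_rowmotion:
  assumes "generic f" "set vs \<subseteq> rect r s"
  shows "rowmotion_defined (rect r s) vs f \<and> generic (birational_rowmotion (rect r s) vs f)"
  using assms(2)
  by (induction vs) (auto simp: birational_rowmotion_def assms(1) generic_toggle)

lemma generic_labeling_in_rowmotion_labelings:
  assumes "linear_extension (rect r s) vs"
  shows "(generic_labeling :: _ \<Rightarrow> 'k::field ratfun) \<in> rowmotion_labelings (rect r s) vs"
proof -
  have vs: "set vs \<subseteq> rect r s" using assms by (simp add: linear_extension_def)
  have "field_morphism (\<lambda>z :: 'k ratfun. z)"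
    by unfold_locales simp_all
  then have "generic (generic_labeling :: _ \<Rightarrow> 'k ratfun)"
    unfolding generic_def by (intro exI[of _ "\<lambda>z. z"]) (simp add: comp_def)
  then have "generic ((birational_rowmotion (rect r s) vs ^^ k) (generic_labeling :: _ \<Rightarrow> 'k ratfun))" for k
    by (induction k) (simp_all add: generic_rowmotion[OF _ vs])
  then show ?thesis
    by (simp add: rowmotion_labelings_def generic_rowmotion[OF _ vs])
qed

section \<open>File products of rowmotion orbits\<close>

lemma prod_file_rowmotion:
  fixes f :: "(nat \<times> nat) hat \<Rightarrow> 'k::field"
  assumes "linear_extension (rect r s) vs" "f \<in> rowmotion_labelings (rect r s) vs"
  shows "(\<Prod>k<r + s + 2. \<Prod>v\<in>file_of r s q. (birational_rowmotion (rect r s) vs ^^ k) f (Elt v)) = 1"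
proof -
  interpret rowmotion_orbit r s "\<lambda>k i j. (birational_rowmotion (rect r s) vs ^^ k) f (Elt (i, j))"
    by (rule rowmotion_orbit_rect[OF assms])
  show ?thesis using prod_file_product[of q] by (simp add: split_def)
qed

text \<open>The \<open>n\<close>-th iterate may itself serve as the initial labeling; the offset
  \<open>n = 1\<close> gives the shifted exponents in (a) to (c).\<close>

lemma prod_file_rho:
  assumes "linear_extension (rect r s) vs"
  shows "(\<Prod>k=0..r + s + 1. \<Prod>v\<in>file_of r s q. rho r s vs (k + n) v) = (1 :: 'k::field ratfun)"
proof -
  let ?f = "(birational_rowmotion (rect r s) vs ^^ n) generic_labeling :: _ \<Rightarrow> 'k ratfun"
  have "?f Bot = 1 \<and> ?f Top = 1"
    by (induction n) simp_all
  then have "?f \<in> rowmotion_labelings (rect r s) vs"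
    using generic_labeling_in_rowmotion_labelings[OF assms, where 'k = 'k]
    by (simp add: rowmotion_labelings_def flip: funpow_add[THEN fun_cong, unfolded o_def])
  moreover have "{0..r + s + 1} = {..<r + s + 2}" by auto
  ultimately show ?thesis
    using prod_file_rowmotion[OF assms, of ?f q] by (simp add: rho_def funpow_add)
qed

lemma bij_betw_file_right:
  assumes "d \<le> s" "d \<le> r"
  shows "bij_betw (\<lambda>c. (r - c, d - c)) {0..d} (file_of r s (int d - int r))"
  using assms
  by (intro bij_betw_byWitness[where f' = "\<lambda>(i, j). r - i"])
    (auto simp: file_of_def rect_def)

text \<open>The file ends when the first of the two coordinates reaches \<open>0\<close>, so
  \<open>min d s\<close> serves both (b) and (c).\<close>

lemma bij_betw_file_top:
  assumes "d \<le> r"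
  shows "bij_betw (\<lambda>c. (d - c, s - c)) {0..min d s} (file_of r s (int s - int d))"
  using assms
  by (intro bij_betw_byWitness[where f' = "\<lambda>(i, j). s - j"])
    (auto simp: file_of_def rect_def)

lemma file_upper_boundary:
  assumes "file_of r s q \<noteq> {}"
  shows "\<exists>!v. v \<in> file_of r s q \<inter> upper_boundary r s"
proof -
  obtain i j where ij: "i \<le> r" "j \<le> s" "int j - int i = q"
    using assms by (auto simp: file_of_def rect_def)
  \<comment> \<open>The number of diagonal steps from \<open>(i, j)\<close> up to the
    boundary.\<close>
  define m where "m = min (r - i) (s - j)"
  have "(i + m, j + m) \<in> file_of r s q \<inter> upper_boundary r s"
    using ij by (auto simp: m_def file_of_def rect_def upper_boundary_def min_def)
  moreover have "v = w" if "v \<in> file_of r s q \<inter> upper_boundary r s"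
      "w \<in> file_of r s q \<inter> upper_boundary r s" for v w
    using that by (auto simp: file_of_def rect_def upper_boundary_def)
  ultimately show ?thesis by blast
qed

theorem theorem2p16:
  fixes r s :: nat and vs :: "(nat \<times> nat) list"
  assumes "linear_extension (rect r s) vs"
  shows
    "(\<forall>q. (\<Prod>k=0..r+s+1. \<Prod>v\<in>file_of r s q. rho r s vs k v) = (1 :: 'k::field ratfun)) \<and>
     (\<forall>q. birationally_homomesic
            (birational_rowmotion (rect r s) vs) (r+s+2)
            (rowmotion_labelings (rect r s) vs)
            (\<lambda>f :: (nat \<times> nat) hat \<Rightarrow> 'k. \<Prod>v\<in>file_of r s q. f (Elt v))) \<and>
     (\<forall>q. file_of r s q \<noteq> {} \<longrightarrow> (\<exists>!v. v \<in> file_of r s q \<inter> upper_boundary r s)) \<and>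
     (s \<le> r \<longrightarrow>
       (\<forall>d. d < s \<longrightarrow>
          bij_betw (\<lambda>c. (r - c, d - c)) {0..d} (file_of r s (int d - int r)) \<and>
          (\<Prod>k=0..r+s+1. \<Prod>c=0..d. rho r s vs (k+1) (r - c, d - c)) = (1 :: 'k ratfun)) \<and>
       (\<forall>d. d < s \<longrightarrow>
          bij_betw (\<lambda>c. (d - c, s - c)) {0..d} (file_of r s (int s - int d)) \<and>
          (\<Prod>k=0..r+s+1. \<Prod>c=0..d. rho r s vs (k+1) (d - c, s - c)) = (1 :: 'k ratfun)) \<and>
       (\<forall>d. s \<le> d \<and> d \<le> r \<longrightarrow>
          bij_betw (\<lambda>c. (d - c, s - c)) {0..s} (file_of r s (int s - int d)) \<and>
          (\<Prod>k=0..r+s+1. \<Prod>c=0..s. rho r s vs (k+1) (d - c, s - c)) = (1 :: 'k ratfun)))"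
proof -
  have reindex: "(\<Prod>k=0..r+s+1. \<Prod>c\<in>C. rho r s vs (k+1) (h c)) = (1 :: 'k ratfun)"
    if "bij_betw h C (file_of r s q)" for h and C :: "nat set" and q
    using prod_file_rho[OF assms, where q = q and n = 1 and 'k = 'k] by (simp only: prod.reindex_bij_betw[OF that])
  show ?thesis
  proof (intro conjI allI impI)
    show "(\<Prod>k=0..r+s+1. \<Prod>v\<in>file_of r s q. rho r s vs k v) = (1 :: 'k ratfun)" for q
      using prod_file_rho[OF assms, where q = q and n = 0 and 'k = 'k] by (simp only: add_0_right)
    show "birationally_homomesic (birational_rowmotion (rect r s) vs) (r+s+2)
        (rowmotion_labelings (rect r s) vs)
        (\<lambda>f :: (nat \<times> nat) hat \<Rightarrow> 'k. \<Prod>v\<in>file_of r s q. f (Elt v))" for q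
      unfolding birationally_homomesic_def using prod_file_rowmotion[OF assms] by blast
    show "\<exists>!v. v \<in> file_of r s q \<inter> upper_boundary r s" if "file_of r s q \<noteq> {}" for q
      using that by (rule file_upper_boundary)
  next
    fix d assume d: "s \<le> r" "d < s"
    show bij: "bij_betw (\<lambda>c. (r - c, d - c)) {0..d} (file_of r s (int d - int r))"
      using d by (intro bij_betw_file_right) simp_all
    show "(\<Prod>k=0..r+s+1. \<Prod>c=0..d. rho r s vs (k+1) (r - c, d - c)) = (1 :: 'k ratfun)"
      by (rule reindex[OF bij])
    show bij: "bij_betw (\<lambda>c. (d - c, s - c)) {0..d} (file_of r s (int s - int d))"
      using bij_betw_file_top[of d r s] d by (simp add: min_absorb1)
    show "(\<Prod>k=0..r+s+1. \<Prod>c=0..d. rho r s vs (k+1) (d - c, s - c)) = (1 :: 'k ratfun)"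
      by (rule reindex[OF bij])
  next
    fix d assume d: "s \<le> d \<and> d \<le> r"
    show bij: "bij_betw (\<lambda>c. (d - c, s - c)) {0..s} (file_of r s (int s - int d))"
      using bij_betw_file_top[of d r s] d by (simp add: min_absorb2)
    show "(\<Prod>k=0..r+s+1. \<Prod>c=0..s. rho r s vs (k+1) (d - c, s - c)) = (1 :: 'k ratfun)"
      by (rule reindex[OF bij])
  qed
qed

end
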